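(* Let $\omega_0=(\tfrac13,\tfrac12)$, let $\omega'\in\mathbb C^2\setminus S$ with $\omega'\neq\omega_0$, and let $\gamma$ be a path in $\mathbb C^2\setminus S$ from $\omega_0$ to $\omega'$. For every $\mathbf F=(F_1,\dots,F_9)\in\underline{\mathcal S}_{\omega_0}$ and every $i\in\{1,\dots,9\}$, the germ $F_i$ admits an analytic continuation along the path $\gamma_i:=U_i\circ\gamma$; denote by $F_i^{[\gamma_i]}$ the resulting germ of holomorphic function at $U_i(\omega')$. Then $\mathbf F^{[\gamma]}:=(F_1^{[\gamma_1]},\dots,F_9^{[\gamma_9]})$ belongs to $\underline{\mathcal S}_{\omega'}$, and the map $\mathbf F\mapsto\mathbf F^{[\gamma]}$ is a linear isomorphism from $\underline{\mathcal S}_{\omega_0}$ onto $\underline{\mathcal S}_{\omega'}$.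
   Context: The functions $U_i$ are the rational functions $$U_1=x,\quad U_2=y,\quad U_3=\frac{x}{y},\quad U_4=\frac{1-y}{1-x},\quad U_5=\frac{x(1-y)}{y(1-x)},\quad U_6=xy,$$ $$U_7=\frac{x(1-y)}{x-1},\quad U_8=\frac{1-y}{y(x-1)},\quad U_9=\frac{x(1-y)^2}{y(1-x)^2}$$ on $\mathbb C^2$. Let $S'\subset\mathbb C^2$ be the union of the polar loci of the $U_i$ and $$S=S'\cup\bigcup_{i<j}\{\eta\in\mathbb C^2:\ dU_i\wedge dU_j(\eta)=0\}.$$ For $\omega\in\mathbb C^2\setminus S$, $\underline{\mathcal S}_{\omega}$ denotes the complex vector space of 9-tuples $(F_1,\dots,F_9)$, with $F_i$ a germ of holomorphic function of one complex variable at $U_i(\omega)$, such that $\sum_{i=1}^9F_i(U_i)=0$ as a germ of holomorphic function at $\omega$. *)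

theory Defs
  imports "HOL-Complex_Analysis.Complex_Analysis" "HOL-Algebra.Module"
begin

section \<open>The web functions and the singular locus\<close>

text \<open>
  Each fraction \<open>webU_num i / webU_den i\<close> (for \<open>1 \<le> i \<le> 9\<close>) is in lowest terms, so
  the polar locus of \<open>webU i\<close> is the zero set of \<open>webU_den i\<close>. It contains the
  indeterminacy points, such as \<open>(0, 0)\<close> for \<open>x / y\<close>.
\<close>

definition webU_num :: "nat \<Rightarrow> complex \<times> complex \<Rightarrow> complex" where
  "webU_num i = (\<lambda>(x, y).
     [x, y, x, 1 - y, x * (1 - y), x * y, x * (1 - y), 1 - y, x * (1 - y)^2] ! (i - 1))"

definition webU_den :: "nat \<Rightarrow> complex \<times> complex \<Rightarrow> complex" where
  "webU_den i = (\<lambda>(x, y).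
     [1, 1, y, 1 - x, y * (1 - x), 1, x - 1, y * (x - 1), y * (1 - x)^2] ! (i - 1))"

definition webU :: "nat \<Rightarrow> complex \<times> complex \<Rightarrow> complex" where
  "webU i p = webU_num i p / webU_den i p"

definition polar_locus :: "(complex \<times> complex) set" where
  "polar_locus = (\<Union>i\<in>{1..9}. {p. webU_den i p = 0})"

definition wedge :: "('v \<Rightarrow> complex) \<Rightarrow> ('v \<Rightarrow> complex) \<Rightarrow> 'v \<Rightarrow> 'v \<Rightarrow> complex" where
  "wedge \<alpha> \<beta> = (\<lambda>v w. \<alpha> v * \<beta> w - \<alpha> w * \<beta> v)"

text \<open>
  Off the polar locus the Frechet derivative of \<open>webU i\<close> is complex linear: it is the
  holomorphic differential. On the polar locus its value is irrelevant in the union below.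
\<close>

definition singular_locus :: "(complex \<times> complex) set" where
  "singular_locus = polar_locus \<union>
     (\<Union>(i, j) \<in> {(i, j). i \<in> {1..9} \<and> j \<in> {1..9} \<and> i < j}.
        {p. wedge (frechet_derivative (webU i) (at p)) (frechet_derivative (webU j) (at p))
              = (\<lambda>v w. 0)})"

section \<open>Germs of holomorphic functions of one variable\<close>

text \<open>A germ at \<open>z\<close> is an equivalence class of functions under equality near \<open>z\<close>.\<close>

definition germ_at :: "complex \<Rightarrow> (complex \<Rightarrow> complex) \<Rightarrow> (complex \<Rightarrow> complex) set" where
  "germ_at z f = {g. \<forall>\<^sub>F w in nhds z. g w = f w}"

definition holo_germs :: "complex \<Rightarrow> (complex \<Rightarrow> complex) set set" where
  "holo_germs z = germ_at z ` {f. f analytic_on {z}}"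

definition germ_add ::
  "complex \<Rightarrow> (complex \<Rightarrow> complex) set \<Rightarrow> (complex \<Rightarrow> complex) set \<Rightarrow> (complex \<Rightarrow> complex) set"
  where "germ_add z A B = {h. \<exists>f\<in>A. \<exists>g\<in>B. \<forall>\<^sub>F w in nhds z. h w = f w + g w}"

definition germ_scale ::
  "complex \<Rightarrow> complex \<Rightarrow> (complex \<Rightarrow> complex) set \<Rightarrow> (complex \<Rightarrow> complex) set"
  where "germ_scale z c A = {h. \<exists>f\<in>A. \<forall>\<^sub>F w in nhds z. h w = c * f w}"

lemma germ_at_self: "f \<in> germ_at z f"
  by (simp add: germ_at_def)

lemma germ_at_eq_iff: "germ_at z f = germ_at z g \<longleftrightarrow> (\<forall>\<^sub>F w in nhds z. f w = g w)"
proof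
  assume "germ_at z f = germ_at z g"
  then show "\<forall>\<^sub>F w in nhds z. f w = g w"
    using germ_at_self[of f z] by (simp add: germ_at_def)
next
  assume *: "\<forall>\<^sub>F w in nhds z. f w = g w"
  show "germ_at z f = germ_at z g"
    unfolding germ_at_def
  proof (intro Collect_cong iffI)
    fix h assume "\<forall>\<^sub>F w in nhds z. h w = f w"
    with * show "\<forall>\<^sub>F w in nhds z. h w = g w" by eventually_elim simp
  next
    fix h assume "\<forall>\<^sub>F w in nhds z. h w = g w"
    with * show "\<forall>\<^sub>F w in nhds z. h w = f w" by eventually_elim simp
  qed
qed

lemma germ_add_germ_at: "germ_add z (germ_at z f) (germ_at z g) = germ_at z (\<lambda>w. f w + g w)"
proof (intro equalityI subsetI)
  fix h assume "h \<in> germ_add z (germ_at z f) (germ_at z g)"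
  then obtain f' g' where "\<forall>\<^sub>F w in nhds z. f' w = f w" "\<forall>\<^sub>F w in nhds z. g' w = g w"
    "\<forall>\<^sub>F w in nhds z. h w = f' w + g' w"
    by (auto simp: germ_add_def germ_at_def)
  then have "\<forall>\<^sub>F w in nhds z. h w = f w + g w" by eventually_elim simp
  then show "h \<in> germ_at z (\<lambda>w. f w + g w)" by (simp add: germ_at_def)
next
  fix h assume "h \<in> germ_at z (\<lambda>w. f w + g w)"
  then show "h \<in> germ_add z (germ_at z f) (germ_at z g)"
    using germ_at_self by (auto simp: germ_add_def germ_at_def[of z "\<lambda>w. f w + g w"])
qed

lemma germ_scale_germ_at: "germ_scale z c (germ_at z f) = germ_at z (\<lambda>w. c * f w)"
proof (intro equalityI subsetI)
  fix h assume "h \<in> germ_scale z c (germ_at z f)"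
  then obtain f' where "\<forall>\<^sub>F w in nhds z. f' w = f w" "\<forall>\<^sub>F w in nhds z. h w = c * f' w"
    by (auto simp: germ_scale_def germ_at_def)
  then have "\<forall>\<^sub>F w in nhds z. h w = c * f w" by eventually_elim simp
  then show "h \<in> germ_at z (\<lambda>w. c * f w)" by (simp add: germ_at_def)
next
  fix h assume "h \<in> germ_at z (\<lambda>w. c * f w)"
  then show "h \<in> germ_scale z c (germ_at z f)"
    using germ_at_self by (auto simp: germ_scale_def germ_at_def[of z "\<lambda>w. c * f w"])
qed

section \<open>Analytic continuation along a path\<close>

text \<open>
  \<open>B\<close> is obtained from \<open>A\<close> by analytic continuation along \<open>c\<close>: there is a family of germs
  \<open>G t\<close> at \<open>c t\<close>, from \<open>A\<close> to \<open>B\<close>, which near each parameter \<open>t\<close> consists of the germs of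
  one holomorphic function.
\<close>

definition continues_along ::
  "(real \<Rightarrow> complex) \<Rightarrow> (complex \<Rightarrow> complex) set \<Rightarrow> (complex \<Rightarrow> complex) set \<Rightarrow> bool" where
  "continues_along c A B \<longleftrightarrow>
     (\<exists>G. G 0 = A \<and> G 1 = B \<and>
        (\<forall>t\<in>{0..1}. \<exists>f V. open V \<and> c t \<in> V \<and> f holomorphic_on V \<and>
           (\<exists>\<delta>>0. \<forall>s\<in>{0..1}. \<bar>s - t\<bar> < \<delta> \<longrightarrow> c s \<in> V \<and> G s = germ_at (c s) f)))"

definition continuation ::
  "(real \<Rightarrow> complex) \<Rightarrow> (complex \<Rightarrow> complex) set \<Rightarrow> (complex \<Rightarrow> complex) set" where
  "continuation c A = (THE B. continues_along c A B)"

definition tuple_continuation ::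
  "(real \<Rightarrow> complex \<times> complex) \<Rightarrow> (nat \<Rightarrow> (complex \<Rightarrow> complex) set)
     \<Rightarrow> (nat \<Rightarrow> (complex \<Rightarrow> complex) set)" where
  "tuple_continuation \<gamma> F = (\<lambda>i\<in>{1..9}. continuation (webU i \<circ> \<gamma>) (F i))"

section \<open>The solution spaces as complex vector spaces\<close>

definition complex_field :: "complex ring" where
  "complex_field = \<lparr>carrier = UNIV, mult = (*), one = 1, zero = 0, add = (+)\<rparr>"

definition solutions :: "complex \<times> complex \<Rightarrow> (nat \<Rightarrow> (complex \<Rightarrow> complex) set) set" where
  "solutions \<omega> = {F \<in> (\<Pi>\<^sub>E i\<in>{1..9}. holo_germs (webU i \<omega>)).
     \<exists>f. (\<forall>i\<in>{1..9}. f i \<in> F i) \<and> (\<forall>\<^sub>F p in nhds \<omega>. (\<Sum>i=1..9. f i (webU i p)) = 0)}"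

text \<open>The ring multiplication required by the record type plays no role in a module.\<close>

definition solution_space ::
  "complex \<times> complex \<Rightarrow> (complex, nat \<Rightarrow> (complex \<Rightarrow> complex) set) module" where
  "solution_space \<omega> =
     \<lparr>carrier = solutions \<omega>, mult = undefined, one = undefined,
      zero = (\<lambda>i\<in>{1..9}. germ_at (webU i \<omega>) (\<lambda>w. 0)),
      add = (\<lambda>F G. \<lambda>i\<in>{1..9}. germ_add (webU i \<omega>) (F i) (G i)),
      smult = (\<lambda>c F. \<lambda>i\<in>{1..9}. germ_scale (webU i \<omega>) c (F i))\<rparr>"

definition linear_iso ::
  "('a, 'm) ring_scheme \<Rightarrow> ('a, 'b, 'n) module_scheme \<Rightarrow> ('a, 'c, 'p) module_scheme
     \<Rightarrow> ('b \<Rightarrow> 'c) \<Rightarrow> bool" where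
  "linear_iso R M N \<phi> \<longleftrightarrow>
     bij_betw \<phi> (carrier M) (carrier N) \<and>
     (\<forall>x\<in>carrier M. \<forall>y\<in>carrier M. \<phi> (x \<oplus>\<^bsub>M\<^esub> y) = \<phi> x \<oplus>\<^bsub>N\<^esub> \<phi> y) \<and>
     (\<forall>a\<in>carrier R. \<forall>x\<in>carrier M. \<phi> (a \<odot>\<^bsub>M\<^esub> x) = a \<odot>\<^bsub>N\<^esub> \<phi> x)"

lemma solutionsE:
  assumes "F \<in> solutions \<omega>"
  obtains f where "F = (\<lambda>i\<in>{1..9}. germ_at (webU i \<omega>) (f i))"
    "\<And>i. i \<in> {1..9} \<Longrightarrow> f i analytic_on {webU i \<omega>}"
    "\<forall>\<^sub>F p in nhds \<omega>. (\<Sum>i=1..9. f i (webU i p)) = 0"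
proof -
  from assms have F: "F \<in> (\<Pi>\<^sub>E i\<in>{1..9}. holo_germs (webU i \<omega>))"
    by (simp add: solutions_def)
  from assms obtain f where f: "\<And>i. i \<in> {1..9} \<Longrightarrow> f i \<in> F i"
    "\<forall>\<^sub>F p in nhds \<omega>. (\<Sum>i=1..9. f i (webU i p)) = 0"
    unfolding solutions_def by blast
  have *: "F i = germ_at (webU i \<omega>) (f i) \<and> f i analytic_on {webU i \<omega>}" if i: "i \<in> {1..9}" for i
  proof -
    have "F i \<in> holo_germs (webU i \<omega>)" using F i by (rule PiE_mem)
    then obtain g where g: "F i = germ_at (webU i \<omega>) g" "g analytic_on {webU i \<omega>}"
      by (auto simp: holo_germs_def)
    have ev: "\<forall>\<^sub>F w in nhds (webU i \<omega>). f i w = g w"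
      using f(1)[OF i] g(1) by (simp add: germ_at_def)
    then have "F i = germ_at (webU i \<omega>) (f i)"
      using g(1) germ_at_eq_iff by blast
    moreover have "f i analytic_on {webU i \<omega>}"
      using analytic_at_cong[OF ev refl] g(2) by simp
    ultimately show ?thesis by blast
  qed
  have "F = (\<lambda>i\<in>{1..9}. germ_at (webU i \<omega>) (f i))"
  proof
    fix i show "F i = (\<lambda>i\<in>{1..9}. germ_at (webU i \<omega>) (f i)) i"
      using * PiE_arb[OF F] by (cases "i \<in> {1..9}") auto
  qed
  then show ?thesis using that * f(2) by blast
qed

lemma solutionsI:
  assumes "\<And>i. i \<in> {1..9} \<Longrightarrow> f i analytic_on {webU i \<omega>}"
    "\<forall>\<^sub>F p in nhds \<omega>. (\<Sum>i=1..9. f i (webU i p)) = 0"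
  shows "(\<lambda>i\<in>{1..9}. germ_at (webU i \<omega>) (f i)) \<in> solutions \<omega>"
  unfolding solutions_def using assms germ_at_self
  by (auto simp: holo_germs_def intro!: exI[of _ f])

lemma tuple_add:
  "(\<lambda>i\<in>I. germ_add (z i) ((\<lambda>i\<in>I. germ_at (z i) (f i)) i) ((\<lambda>i\<in>I. germ_at (z i) (g i)) i))
     = (\<lambda>i\<in>I. germ_at (z i) (\<lambda>w. f i w + g i w))"
  by (auto simp: fun_eq_iff germ_add_germ_at)

lemma tuple_scale:
  "(\<lambda>i\<in>I. germ_scale (z i) c ((\<lambda>i\<in>I. germ_at (z i) (f i)) i))
     = (\<lambda>i\<in>I. germ_at (z i) (\<lambda>w. c * f i w))"
  by (auto simp: fun_eq_iff germ_scale_germ_at)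

lemma field_complex_field: "field complex_field"
proof -
  have "cring complex_field"
  proof (rule cringI)
    show "abelian_group complex_field"
      by (rule abelian_groupI)
        (auto simp: complex_field_def algebra_simps intro: exI[of _ "- x" for x])
    show "Group.comm_monoid complex_field"
      by (rule comm_monoidI) (auto simp: complex_field_def)
  qed (auto simp: complex_field_def algebra_simps)
  then show ?thesis
  proof (rule cring.cring_fieldI2)
    show "\<zero>\<^bsub>complex_field\<^esub> \<noteq> \<one>\<^bsub>complex_field\<^esub>" by (simp add: complex_field_def)
    fix a assume "a \<noteq> \<zero>\<^bsub>complex_field\<^esub>"
    then show "\<exists>b\<in>carrier complex_field. a \<otimes>\<^bsub>complex_field\<^esub> b = \<one>\<^bsub>complex_field\<^esub>"
      by (intro bexI[of _ "inverse a"]) (auto simp: complex_field_def)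
  qed
qed

lemma module_solution_space: "Module.module complex_field (solution_space \<omega>)"
proof (rule moduleI)
  let ?S = "solution_space \<omega>"
  show "cring complex_field"
    using field_complex_field by (simp add: field_def domain_def)
  have add_closed: "x \<oplus>\<^bsub>?S\<^esub> y \<in> carrier ?S" if xy: "x \<in> carrier ?S" "y \<in> carrier ?S" for x y
  proof -
    obtain f where f: "x = (\<lambda>i\<in>{1..9}. germ_at (webU i \<omega>) (f i))"
      "\<And>i. i \<in> {1..9} \<Longrightarrow> f i analytic_on {webU i \<omega>}"
      "\<forall>\<^sub>F p in nhds \<omega>. (\<Sum>i=1..9. f i (webU i p)) = 0"
      using solutionsE[of x \<omega>] xy by (auto simp: solution_space_def)
    obtain g where g: "y = (\<lambda>i\<in>{1..9}. germ_at (webU i \<omega>) (g i))"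
      "\<And>i. i \<in> {1..9} \<Longrightarrow> g i analytic_on {webU i \<omega>}"
      "\<forall>\<^sub>F p in nhds \<omega>. (\<Sum>i=1..9. g i (webU i p)) = 0"
      using solutionsE[of y \<omega>] xy by (auto simp: solution_space_def)
    have "\<forall>\<^sub>F p in nhds \<omega>. (\<Sum>i=1..9. f i (webU i p) + g i (webU i p)) = 0"
      using f(3) g(3) by eventually_elim (simp only: sum.distrib add_0)
    then show ?thesis
      unfolding f(1) g(1) solution_space_def
      by (simp only: module.simps ring.simps partial_object.simps tuple_add)
        (intro solutionsI analytic_intros f(2) g(2); assumption)
  qed
  have scale_closed: "c \<odot>\<^bsub>?S\<^esub> x \<in> carrier ?S" if x: "x \<in> carrier ?S" for c x
  proof -
    obtain f where f: "x = (\<lambda>i\<in>{1..9}. germ_at (webU i \<omega>) (f i))"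
      "\<And>i. i \<in> {1..9} \<Longrightarrow> f i analytic_on {webU i \<omega>}"
      "\<forall>\<^sub>F p in nhds \<omega>. (\<Sum>i=1..9. f i (webU i p)) = 0"
      using solutionsE[of x \<omega>] x by (auto simp: solution_space_def)
    have "\<forall>\<^sub>F p in nhds \<omega>. (\<Sum>i=1..9. c * f i (webU i p)) = 0"
      using f(3) by eventually_elim (simp only: sum_distrib_left[symmetric] mult_zero_right)
    then show ?thesis
      unfolding f(1) solution_space_def
      by (simp only: module.simps ring.simps partial_object.simps tuple_scale)
        (intro solutionsI analytic_intros f(2); assumption)
  qed
  have rep: "\<exists>f. x = (\<lambda>i\<in>{1..9}. germ_at (webU i \<omega>) (f i))" if "x \<in> carrier ?S" for x
    using solutionsE[of x \<omega>] that by (auto simp: solution_space_def)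
  note ops = solution_space_def module.simps ring.simps partial_object.simps tuple_add tuple_scale
  show "abelian_group ?S"
  proof (rule abelian_groupI)
    show "\<zero>\<^bsub>?S\<^esub> \<in> carrier ?S"
      using solutionsI[of "\<lambda>i w. 0" \<omega>] by (simp add: solution_space_def)
    fix x assume x: "x \<in> carrier ?S"
    show "\<zero>\<^bsub>?S\<^esub> \<oplus>\<^bsub>?S\<^esub> x = x"
      using rep[OF x] by (elim exE, simp only: ops) simp
    have "(- 1) \<odot>\<^bsub>?S\<^esub> x \<oplus>\<^bsub>?S\<^esub> x = \<zero>\<^bsub>?S\<^esub>"
      using rep[OF x] by (elim exE, simp only: ops) simp
    then show "\<exists>y\<in>carrier ?S. y \<oplus>\<^bsub>?S\<^esub> x = \<zero>\<^bsub>?S\<^esub>"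
      using scale_closed[OF x] by blast
    fix y assume y: "y \<in> carrier ?S"
    show "x \<oplus>\<^bsub>?S\<^esub> y \<in> carrier ?S" using x y by (rule add_closed)
    show "x \<oplus>\<^bsub>?S\<^esub> y = y \<oplus>\<^bsub>?S\<^esub> x"
      using rep[OF x] rep[OF y] by (elim exE, simp only: ops) (simp add: add.commute)
    fix z assume z: "z \<in> carrier ?S"
    show "x \<oplus>\<^bsub>?S\<^esub> y \<oplus>\<^bsub>?S\<^esub> z = x \<oplus>\<^bsub>?S\<^esub> (y \<oplus>\<^bsub>?S\<^esub> z)"
      using rep[OF x] rep[OF y] rep[OF z] by (elim exE, simp only: ops) (simp add: add.assoc)
  qed
  fix a b x y assume x: "x \<in> carrier ?S"
  show "a \<odot>\<^bsub>?S\<^esub> x \<in> carrier ?S" using x by (rule scale_closed)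
  show "(a \<oplus>\<^bsub>complex_field\<^esub> b) \<odot>\<^bsub>?S\<^esub> x = a \<odot>\<^bsub>?S\<^esub> x \<oplus>\<^bsub>?S\<^esub> b \<odot>\<^bsub>?S\<^esub> x"
    using rep[OF x] by (elim exE, simp only: ops) (simp add: complex_field_def distrib_right)
  show "(a \<otimes>\<^bsub>complex_field\<^esub> b) \<odot>\<^bsub>?S\<^esub> x = a \<odot>\<^bsub>?S\<^esub> (b \<odot>\<^bsub>?S\<^esub> x)"
    using rep[OF x] by (elim exE, simp only: ops) (simp add: complex_field_def mult.assoc)
  show "\<one>\<^bsub>complex_field\<^esub> \<odot>\<^bsub>?S\<^esub> x = x"
    using rep[OF x] by (elim exE, simp only: ops) (simp add: complex_field_def)
  assume y: "y \<in> carrier ?S"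
  show "a \<odot>\<^bsub>?S\<^esub> (x \<oplus>\<^bsub>?S\<^esub> y) = a \<odot>\<^bsub>?S\<^esub> x \<oplus>\<^bsub>?S\<^esub> a \<odot>\<^bsub>?S\<^esub> y"
    using rep[OF x] rep[OF y] by (elim exE, simp only: ops) (simp add: distrib_left)
qed

end

theory Submission
  imports Defs
begin

text \<open>
  Analytic continuation along a path preserves the relation \<open>\<Sum>i. F i (U i) = 0\<close> by the identity
  theorem. What has to be shown is that the continuation exists, and for this it suffices to
  have uniform extension: every \<open>\<omega>\<close> outside the singular locus has a ball such that a solution
  at any point of the ball extends to the whole ball (\<open>solutions_extend\<close>). The path is then
  divided into pieces, each contained in one such ball, and solutions are transported through
  them in both directions (\<open>transports_exist\<close>); transport backwards gives surjectivity, and the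
  identity theorem gives uniqueness and injectivity (\<open>continues_on_unique\<close>).

  Uniform extension uses only that the differentials \<open>dU\<^sub>i\<close> are pairwise independent. Suppose the
  \<open>F i\<close> of a solution at \<open>\<eta>\<close> are holomorphic on the discs of radius \<open>n i * r\<close> around \<open>U i \<eta>\<close>,
  where \<open>n i\<close> is the norm of \<open>dU\<^sub>i\<close>. Move from \<open>\<eta>\<close> along the complex line in the direction
  \<open>v j\<close> of the conjugate gradient of \<open>U j\<close>. There \<open>U j\<close> moves at its maximal speed \<open>n j\<close>,
  whereas by the strict Cauchy-Schwarz inequality each other \<open>U i\<close> moves at a speed strictly
  below its maximum \<open>n i\<close>. So one can go a little further than the distance \<open>r\<close>, by a
  factor greater than 1, while all \<open>U i\<close> with \<open>i \<noteq> j\<close> remain in their discs. There the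
  relation \<open>F j (U j) = - (\<Sum>i\<noteq>j. F i (U i))\<close> extends \<open>F j\<close> to a larger disc
  (\<open>extend_step_one\<close>). The growth factor is governed by the linear parts at \<open>\<omega>\<close> alone, the nonlinear
  errors being relatively small near \<open>\<omega>\<close>, and hence does not depend on \<open>\<eta>\<close> or \<open>r\<close>.
  Iterating, the radii grow geometrically up to a size that depends only on \<open>\<omega>\<close>
  (\<open>extends_to_uniform\<close>), however small the initial domains are.
\<close>

section \<open>Holomorphic functions of two variables\<close>

text \<open>
  The linear form with coefficient vector \<open>a\<close>; for the coefficient vector of a differential
  \<open>dU\<close> it is that differential.
\<close>

definition lin2 :: "complex \<times> complex \<Rightarrow> complex \<times> complex \<Rightarrow> complex" where
  "lin2 a v = fst a * fst v + snd a * snd v"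

text \<open>
  Here \<open>D\<close> is the pair of partial derivatives. Its continuity is built in, since the argument
  needs strict differentiability and not only the existence of the derivative.
\<close>

definition holo2_on ::
  "(complex \<times> complex \<Rightarrow> complex) \<Rightarrow> (complex \<times> complex \<Rightarrow> complex \<times> complex)
     \<Rightarrow> (complex \<times> complex) set \<Rightarrow> bool" where
  "holo2_on U D \<Omega> \<longleftrightarrow>
     continuous_on \<Omega> D \<and> (\<forall>p\<in>\<Omega>. (U has_derivative lin2 (D p)) (at p))"

lemma holo2_on_continuous: "holo2_on U D \<Omega> \<Longrightarrow> continuous_on \<Omega> U"
  unfolding holo2_on_def
  by (meson continuous_at_imp_continuous_on has_derivative_continuous)

lemma holo2_on_const: "holo2_on (\<lambda>p. c) (\<lambda>p. (0, 0)) \<Omega>"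
  unfolding holo2_on_def lin2_def by (auto simp: fun_eq_iff intro!: continuous_intros)

lemma holo2_on_fst: "holo2_on fst (\<lambda>p. (1, 0)) \<Omega>"
  unfolding holo2_on_def lin2_def
  by (auto intro!: continuous_intros has_derivative_eq_rhs[OF has_derivative_fst[OF has_derivative_ident]])

lemma holo2_on_snd: "holo2_on snd (\<lambda>p. (0, 1)) \<Omega>"
  unfolding holo2_on_def lin2_def
  by (auto intro!: continuous_intros has_derivative_eq_rhs[OF has_derivative_snd[OF has_derivative_ident]])

lemma holo2_on_diff:
  assumes "holo2_on U D \<Omega>" "holo2_on V E \<Omega>"
  shows "holo2_on (\<lambda>p. U p - V p) (\<lambda>p. D p - E p) \<Omega>"
  using assms unfolding holo2_on_def
  by (auto intro!: continuous_intros has_derivative_eq_rhs[OF has_derivative_diff]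
      simp: lin2_def fun_eq_iff algebra_simps)

lemma holo2_on_mult:
  assumes "holo2_on U D \<Omega>" "holo2_on V E \<Omega>"
  shows "holo2_on (\<lambda>p. U p * V p)
     (\<lambda>p. (U p * fst (E p) + fst (D p) * V p, U p * snd (E p) + snd (D p) * V p)) \<Omega>"
  using assms holo2_on_continuous[OF assms(1)] holo2_on_continuous[OF assms(2)]
  unfolding holo2_on_def
  by (auto intro!: continuous_intros has_derivative_eq_rhs[OF has_derivative_mult]
      simp: lin2_def fun_eq_iff algebra_simps)

lemma holo2_on_divide:
  assumes "holo2_on U D \<Omega>" "holo2_on V E \<Omega>" "\<And>p. p \<in> \<Omega> \<Longrightarrow> V p \<noteq> 0"
  shows "holo2_on (\<lambda>p. U p / V p)
     (\<lambda>p. ((fst (D p) * V p - U p * fst (E p)) / (V p * V p),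
           (snd (D p) * V p - U p * snd (E p)) / (V p * V p))) \<Omega>"
  using assms holo2_on_continuous[OF assms(1)] holo2_on_continuous[OF assms(2)]
  unfolding holo2_on_def
  by (auto intro!: continuous_intros has_derivative_eq_rhs[OF has_derivative_divide']
      simp: lin2_def fun_eq_iff divide_simps algebra_simps)

lemma norm_lin2_le: "norm (lin2 a v) \<le> norm a * norm v"
proof -
  have "norm (lin2 a v) \<le> norm (fst a) * norm (fst v) + norm (snd a) * norm (snd v)"
    unfolding lin2_def by (metis norm_mult norm_triangle_ineq)
  also have "\<dots> = (norm (fst a), norm (snd a)) \<bullet> (norm (fst v), norm (snd v))"
    by (simp add: inner_Pair)
  also have "\<dots> \<le> norm (norm (fst a), norm (snd a)) * norm (norm (fst v), norm (snd v))"
    by (rule norm_cauchy_schwarz)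
  also have "\<dots> = norm a * norm v"
    by (simp add: norm_Pair norm_prod_def)
  finally show ?thesis .
qed

text \<open>
  Near \<open>\<omega>\<close> increments of \<open>U\<close> are controlled by the single linear form \<open>dU(\<omega>)\<close>, between any two
  points and not only from \<open>\<omega>\<close>. This makes all later constants uniform in the base point \<open>\<eta>\<close>.
  It is the mean value inequality for \<open>U - dU(\<omega>)\<close>.
\<close>

lemma holo2_on_strict:
  assumes "open \<Omega>" "\<omega> \<in> \<Omega>" "holo2_on U D \<Omega>" "e > 0"
  shows "\<forall>\<^sub>F \<rho> in at_right 0. ball \<omega> \<rho> \<subseteq> \<Omega> \<and>
    (\<forall>p\<in>ball \<omega> \<rho>. \<forall>q\<in>ball \<omega> \<rho>. norm (U p - U q - lin2 (D \<omega>) (p - q)) \<le> e * norm (p - q))"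
proof -
  obtain d1 where d1: "d1 > 0" "ball \<omega> d1 \<subseteq> \<Omega>"
    using assms(1,2) open_contains_ball by blast
  have "isCont D \<omega>"
    using assms(1-3) by (simp add: continuous_on_eq_continuous_at holo2_on_def)
  then obtain d2 where d2: "d2 > 0" "\<And>p. dist p \<omega> < d2 \<Longrightarrow> dist (D p) (D \<omega>) < e"
    using assms(4) unfolding continuous_at by (metis LIM_def dist_self)
  have "ball \<omega> \<rho> \<subseteq> \<Omega> \<and>
    (\<forall>p\<in>ball \<omega> \<rho>. \<forall>q\<in>ball \<omega> \<rho>. norm (U p - U q - lin2 (D \<omega>) (p - q)) \<le> e * norm (p - q))"
    if \<rho>: "0 < \<rho>" "\<rho> < min d1 d2" for \<rho>
  proof (intro conjI ballI)
    show sub: "ball \<omega> \<rho> \<subseteq> \<Omega>" using d1 \<rho> by auto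
    fix p q assume pq: "p \<in> ball \<omega> \<rho>" "q \<in> ball \<omega> \<rho>"
    define g where "g = (\<lambda>p. U p - lin2 (D \<omega>) p)"
    have bl: "bounded_linear (lin2 (D \<omega>))"
      unfolding lin2_def by (intro bounded_linear_intros)
    have "norm (g p - g q) \<le> e * norm (p - q)"
    proof (rule differentiable_bound[OF convex_ball _ _ pq])
      fix x assume x: "x \<in> ball \<omega> \<rho>"
      have "(U has_derivative lin2 (D x)) (at x)"
        using assms(3) sub x by (auto simp: holo2_on_def)
      then have "(g has_derivative (\<lambda>v. lin2 (D x) v - lin2 (D \<omega>) v)) (at x)"
        unfolding g_def by (intro has_derivative_diff bounded_linear.has_derivative[OF bl] has_derivative_ident)
      then show "(g has_derivative (\<lambda>v. lin2 (D x - D \<omega>) v)) (at x within ball \<omega> \<rho>)"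
        by (rule has_derivative_at_withinI[OF has_derivative_eq_rhs])
           (simp add: lin2_def fun_eq_iff algebra_simps)
      have "dist (D x) (D \<omega>) < e" using x \<rho> d2(2)[of x] by (simp add: dist_commute)
      then have "norm (lin2 (D x - D \<omega>) v) \<le> e * norm v" for v
        using norm_lin2_le[of "D x - D \<omega>" v]
        by (rule_tac order_trans[OF _ mult_right_mono]) (auto simp: dist_norm)
      then show "onorm (lin2 (D x - D \<omega>)) \<le> e"
        using assms(4) by (intro onorm_bound) auto
    qed
    then show "norm (U p - U q - lin2 (D \<omega>) (p - q)) \<le> e * norm (p - q)"
      by (simp add: g_def lin2_def algebra_simps)
  qed
  then show ?thesis
    unfolding eventually_at_right_field
    using d1(1) d2(1) by (intro exI[of _ "min d1 d2"]) auto
qed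

text \<open>
  Complex multiples of a vector of \<open>\<complex>\<^sup>2\<close>; as a product type it carries only the real
  scalar multiplication.
\<close>

definition cscale :: "complex \<Rightarrow> complex \<times> complex \<Rightarrow> complex \<times> complex" where
  "cscale t v = (t * fst v, t * snd v)"

lemma norm_cscale: "norm (cscale t v) = norm t * norm v"
  by (simp add: cscale_def norm_prod_def norm_mult power_mult_distrib real_sqrt_mult
      flip: distrib_left)

lemma dist_cscale: "dist \<eta> (\<eta> + cscale t v) = norm t * norm v"
  by (metis add_diff_cancel_left' dist_commute dist_norm norm_cscale)

lemma cscale_0 [simp]: "cscale 0 v = 0"
  by (simp add: cscale_def zero_prod_def)

lemma cscale_1 [simp]: "cscale 1 v = v"
  by (simp add: cscale_def)

lemma cscale_diff: "cscale s v - cscale t v = cscale (s - t) v"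
  by (simp add: cscale_def algebra_simps)

lemma lin2_cscale: "lin2 a (cscale t v) = t * lin2 a v"
  by (simp add: lin2_def cscale_def algebra_simps)

lemma tendsto_cscale_0: "filterlim (\<lambda>t. \<eta> + cscale t v) (nhds \<eta>) (nhds 0)"
proof -
  have "isCont (\<lambda>t. \<eta> + cscale t v) 0"
    unfolding cscale_def by (intro continuous_intros)
  then show ?thesis
    using tendsto_at_iff_tendsto_nhds[of "\<lambda>t. \<eta> + cscale t v" 0] by (simp add: isCont_def)
qed

lemma holo2_on_line:
  assumes "open \<Omega>" "holo2_on U D \<Omega>"
  shows "(\<lambda>t. U (\<eta> + cscale t v)) holomorphic_on {t. \<eta> + cscale t v \<in> \<Omega>}"
proof -
  have "((\<lambda>t. U (\<eta> + cscale t v)) has_field_derivative lin2 (D (\<eta> + cscale t v)) v) (at t)"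
    if "\<eta> + cscale t v \<in> \<Omega>" for t
  proof -
    have 1: "((\<lambda>t. \<eta> + cscale t v) has_derivative (\<lambda>s. cscale s v)) (at t)"
      unfolding cscale_def by (auto intro!: derivative_eq_intros simp: zero_prod_def)
    have "(U has_derivative lin2 (D (\<eta> + cscale t v))) (at (\<eta> + cscale t v))"
      using assms that by (auto simp: holo2_on_def)
    from has_derivative_compose[OF 1 this] show ?thesis
      by (simp add: has_field_derivative_def lin2_cscale mult.commute[of _ "lin2 _ v"])
  qed
  then show ?thesis
    using holomorphic_on_def field_differentiable_def has_field_derivative_at_within by fastforce
qed

section \<open>Local extension of solutions\<close>

text \<open>
  What the extension argument needs to know about a web near \<open>\<omega>\<close>. The number \<open>n i\<close> is
  the norm of \<open>dU\<^sub>i(\<omega>)\<close> and \<open>v i\<close> is the unit vector on which this norm is attained, so that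
  along \<open>v i\<close> the function \<open>U i\<close> moves at full speed \<open>n i\<close> up to the relative error \<open>\<epsilon>\<close>
  (\<open>own_line\<close>). By transversality every other \<open>U j\<close> moves along \<open>v i\<close> at a speed
  bounded away from its own maximum \<open>n j\<close> (\<open>other_line\<close>). That the loss \<open>3 * \<epsilon>\<close> of the
  other functions exceeds the error \<open>\<epsilon>\<close> is what lets discs grow.
\<close>

locale local_web =
  fixes I :: "'i set" and U :: "'i \<Rightarrow> complex \<times> complex \<Rightarrow> complex" and \<omega> :: "complex \<times> complex"
    and \<rho> \<epsilon> :: real and n :: "'i \<Rightarrow> real" and v :: "'i \<Rightarrow> complex \<times> complex"
  assumes finite: "finite I" and \<rho>: "0 < \<rho>" and \<epsilon>: "0 < \<epsilon>" "\<epsilon> < 1 / 4"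
    and n_pos: "i \<in> I \<Longrightarrow> 0 < n i"
    and norm_v: "i \<in> I \<Longrightarrow> norm (v i) = 1"
    and holo_line: "i \<in> I \<Longrightarrow>
      (\<lambda>t. U i (\<eta> + cscale t w)) holomorphic_on {t. \<eta> + cscale t w \<in> ball \<omega> \<rho>}"
    and lipschitz: "i \<in> I \<Longrightarrow> p \<in> ball \<omega> \<rho> \<Longrightarrow> q \<in> ball \<omega> \<rho> \<Longrightarrow>
      norm (U i p - U i q) \<le> 2 * n i * norm (p - q)"
    and own_line: "i \<in> I \<Longrightarrow> \<eta> + cscale s (v i) \<in> ball \<omega> \<rho> \<Longrightarrow> \<eta> + cscale t (v i) \<in> ball \<omega> \<rho> \<Longrightarrow>
      norm (U i (\<eta> + cscale s (v i)) - U i (\<eta> + cscale t (v i)) - (s - t) * n i)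
        \<le> \<epsilon> * n i * norm (s - t)"
    and other_line: "i \<in> I \<Longrightarrow> j \<in> I \<Longrightarrow> i \<noteq> j \<Longrightarrow>
      \<eta> \<in> ball \<omega> \<rho> \<Longrightarrow> \<eta> + cscale t (v j) \<in> ball \<omega> \<rho> \<Longrightarrow>
      norm (U i (\<eta> + cscale t (v j)) - U i \<eta>) \<le> (1 - 3 * \<epsilon>) * n i * norm t"
begin

text \<open>
  Travelling the distance \<open>stretch * r\<close> along \<open>v j\<close> is exactly what keeps each other
  \<open>U i\<close> inside its disc of radius \<open>n i * r\<close>; on the way \<open>U j\<close> covers a disc of radius
  \<open>n j * ((1 - \<epsilon>) * stretch * r)\<close>, and \<open>(1 - \<epsilon>) * stretch > 1\<close>.
\<close>

definition stretch :: real where "stretch = 1 / (1 - 3 * \<epsilon>)"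

lemma stretch: "0 < stretch" "stretch < 4" "(1 - 3 * \<epsilon>) * stretch = 1" "1 < (1 - \<epsilon>) * stretch"
  using \<epsilon> by (auto simp: stretch_def field_simps)

lemma own_line_lower:
  assumes "i \<in> I" "\<eta> + cscale s (v i) \<in> ball \<omega> \<rho>" "\<eta> + cscale t (v i) \<in> ball \<omega> \<rho>"
  shows "(1 - \<epsilon>) * n i * norm (s - t) \<le> norm (U i (\<eta> + cscale s (v i)) - U i (\<eta> + cscale t (v i)))"
proof -
  have "norm ((s - t) * n i) = n i * norm (s - t)"
    using n_pos[OF assms(1)] by (simp add: norm_mult)
  moreover have "norm ((s - t) * n i) - norm (U i (\<eta> + cscale s (v i)) - U i (\<eta> + cscale t (v i)))
      \<le> \<epsilon> * n i * norm (s - t)"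
    using own_line[OF assms] by (smt (verit) norm_minus_commute norm_triangle_ineq2)
  ultimately show ?thesis by (simp add: algebra_simps)
qed

lemma continuous_at_center:
  assumes "i \<in> I" "\<eta> \<in> ball \<omega> \<rho>"
  shows "isCont (U i) \<eta>"
proof -
  have "continuous_on (ball \<omega> \<rho>) (U i)"
  proof (rule lipschitz_on_continuous_on[OF lipschitz_onI])
    show "0 \<le> 2 * n i" using n_pos[OF assms(1)] by simp
    show "dist (U i x) (U i y) \<le> 2 * n i * dist x y" if "x \<in> ball \<omega> \<rho>" "y \<in> ball \<omega> \<rho>" for x y
      using lipschitz[OF assms(1) that] by (simp add: dist_norm)
  qed
  then show ?thesis
    using assms(2) by (simp add: continuous_on_eq_continuous_at)
qed

text \<open>
  On the complex line through \<open>\<eta>\<close> in direction \<open>v j\<close> the relation expresses \<open>f j (U j)\<close> by the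
  other summands. These are defined on a disc of the line that \<open>U j\<close> maps biholomorphically
  onto a region containing a disc strictly larger than the one on which \<open>f j\<close> was known, so the
  relation itself extends \<open>f j\<close>.
\<close>

lemma extend_step_one:
  assumes j: "j \<in> I" and r: "r > 0" and sub: "cball \<eta> (stretch * r) \<subseteq> ball \<omega> \<rho>"
    and holo: "\<And>i. i \<in> I \<Longrightarrow> f i holomorphic_on ball (U i \<eta>) (n i * r)"
    and sum0: "\<forall>\<^sub>F p in nhds \<eta>. (\<Sum>i\<in>I. f i (U i p)) = 0"
  shows "\<exists>g. g holomorphic_on ball (U j \<eta>) (n j * ((1 - \<epsilon>) * stretch * r)) \<and>
    (\<forall>\<^sub>F w in nhds (U j \<eta>). g w = f j w)"
proof -
  let ?p = "\<lambda>t. \<eta> + cscale t (v j)"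
  let ?B = "ball 0 (stretch * r) :: complex set"
  define h where "h = (\<lambda>t. U j (?p t))"
  define G where "G = (\<lambda>t. - (\<Sum>i\<in>I - {j}. f i (U i (?p t))))"
  have Lr: "0 < stretch * r" using stretch(1) r by simp
  have pin: "?p t \<in> ball \<omega> \<rho>" if "norm t \<le> stretch * r" for t
  proof -
    have "?p t \<in> cball \<eta> (stretch * r)" using that by (simp add: dist_cscale norm_v[OF j])
    then show ?thesis using sub by blast
  qed
  then have \<eta>: "\<eta> \<in> ball \<omega> \<rho>" using Lr by (metis add.right_neutral cscale_0 less_imp_le norm_zero)
  have holo_U: "(\<lambda>t. U i (?p t)) holomorphic_on ?B" if "i \<in> I" for i
    by (rule holomorphic_on_subset[OF holo_line[OF that]]) (use pin in auto)
  have holoh: "h holomorphic_on ?B" using holo_U[OF j] by (simp add: h_def)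
  have injh: "inj_on h ?B"
  proof (rule inj_onI)
    fix s t assume st: "s \<in> ?B" "t \<in> ?B" "h s = h t"
    have "(1 - \<epsilon>) * n j * norm (s - t) \<le> 0"
      using own_line_lower[OF j pin[of s] pin[of t]] st by (simp add: h_def del: mult_le_0_iff)
    moreover have "0 < (1 - \<epsilon>) * n j" using \<epsilon> n_pos[OF j] by simp
    ultimately show "s = t" using mult_pos_pos[of "(1 - \<epsilon>) * n j" "norm (s - t)"] by fastforce
  qed
  obtain k where k: "k holomorphic_on h ` ?B" "\<And>t. t \<in> ?B \<Longrightarrow> k (h t) = t"
    using holomorphic_has_inverse[OF holoh open_ball injh] by metis
  have open_h: "open (h ` ?B)"
    by (rule open_mapping_thm3[OF holoh open_ball injh])
  have h0: "h 0 = U j \<eta>" by (simp add: h_def)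
  \<comment> \<open>An open map that moves the boundary of a disc by at least \<open>R\<close> from the image of the centre
    covers the disc of radius \<open>R\<close>.\<close>
  have ball_sub: "ball (h 0) (n j * ((1 - \<epsilon>) * stretch * r)) \<subseteq> h ` ?B"
  proof (rule ball_subset_open_map_image)
    have "h holomorphic_on {t. ?p t \<in> ball \<omega> \<rho>}"
      using holo_line[OF j] by (simp add: h_def)
    then show "continuous_on (closure ?B) h"
      by (rule continuous_on_subset[OF holomorphic_on_imp_continuous_on]) (use pin Lr in auto)
    show "open (h ` interior ?B)" using open_h by simp
    fix t assume "t \<in> frontier ?B"
    then have t: "norm t = stretch * r" using Lr by simp
    then show "n j * ((1 - \<epsilon>) * stretch * r) \<le> norm (h t - h 0)"
      using own_line_lower[OF j, of \<eta> t 0] pin[of t] \<eta> by (simp add: h_def ac_simps)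
  qed (use Lr r stretch \<epsilon> n_pos[OF j] in auto)
  have holoG: "G holomorphic_on ?B"
    unfolding G_def
  proof (intro holomorphic_on_minus holomorphic_on_sum)
    fix i assume i: "i \<in> I - {j}"
    have "U i (?p t) \<in> ball (U i \<eta>) (n i * r)" if t: "t \<in> ?B" for t
    proof -
      have pos: "0 < (1 - 3 * \<epsilon>) * n i" using \<epsilon> n_pos[of i] i by simp
      have "norm (U i (?p t) - U i \<eta>) \<le> (1 - 3 * \<epsilon>) * n i * norm t"
        using other_line[of i j \<eta> t] i j \<eta> pin[of t] t by simp
      also have "\<dots> < (1 - 3 * \<epsilon>) * n i * (stretch * r)"
        using t by (intro mult_strict_left_mono[OF _ pos]) simp
      also have "\<dots> = ((1 - 3 * \<epsilon>) * stretch) * (n i * r)" by (simp only: ac_simps)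
      also have "\<dots> = n i * r" by (simp add: stretch(3))
      finally show ?thesis by (simp add: dist_norm norm_minus_commute)
    qed
    then have "(\<lambda>t. U i (?p t)) ` ?B \<subseteq> ball (U i \<eta>) (n i * r)" by blast
    then show "(\<lambda>t. f i (U i (?p t))) holomorphic_on ?B"
      using holomorphic_on_compose_gen[OF holo_U holo, of i i] i by (simp add: o_def)
  qed
  have "(G \<circ> k) holomorphic_on h ` ?B"
    by (rule holomorphic_on_compose_gen[OF k(1) holoG]) (use k(2) in auto)
  then have "(G \<circ> k) holomorphic_on ball (U j \<eta>) (n j * ((1 - \<epsilon>) * stretch * r))"
    using ball_sub h0 by (metis holomorphic_on_subset)
  moreover have "\<forall>\<^sub>F w in nhds (U j \<eta>). (G \<circ> k) w = f j w"
  proof -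
    have "\<forall>\<^sub>F t in nhds 0. (\<Sum>i\<in>I. f i (U i (?p t))) = 0"
      by (rule eventually_compose_filterlim[OF sum0 tendsto_cscale_0])
    then have ev: "\<forall>\<^sub>F t in nhds 0. f j (h t) = G t"
      by eventually_elim
        (simp add: G_def h_def sum.remove[OF finite j] eq_neg_iff_add_eq_0)
    have U_in: "U j \<eta> \<in> h ` ?B" using h0 Lr by (metis centre_in_ball imageI)
    have "isCont k (U j \<eta>)"
      using k(1) open_h U_in holomorphic_on_imp_continuous_on continuous_on_eq_continuous_at by blast
    moreover have "k (U j \<eta>) = 0" using k(2)[of 0] h0 Lr by simp
    ultimately have "filterlim k (nhds 0) (nhds (U j \<eta>))"
      using tendsto_at_iff_tendsto_nhds[of k "U j \<eta>"] by (simp add: isCont_def)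
    then have "\<forall>\<^sub>F w in nhds (U j \<eta>). f j (h (k w)) = G (k w)"
      by (rule eventually_compose_filterlim[OF ev])
    moreover have "\<forall>\<^sub>F w in nhds (U j \<eta>). w \<in> h ` ?B"
      by (rule eventually_nhds_in_open[OF open_h U_in])
    ultimately show ?thesis
      by eventually_elim (use k(2) in auto)
  qed
  ultimately show ?thesis by blast
qed

text \<open>
  Radii are measured in units of \<open>n i\<close>, the size of the image under \<open>U i\<close> of a ball of radius 1.
\<close>

definition extends_to ::
  "complex \<times> complex \<Rightarrow> ('i \<Rightarrow> complex \<Rightarrow> complex) \<Rightarrow> real \<Rightarrow> bool" where
  "extends_to \<eta> f r \<longleftrightarrow> (\<forall>i\<in>I. \<exists>g. g holomorphic_on ball (U i \<eta>) (n i * r) \<and>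
     (\<forall>\<^sub>F w in nhds (U i \<eta>). g w = f i w))"

lemma sum_zero_cong:
  assumes "\<eta> \<in> ball \<omega> \<rho>"
    and ev: "\<And>i. i \<in> I \<Longrightarrow> \<forall>\<^sub>F w in nhds (U i \<eta>). g i w = f i w"
    and sum0: "\<forall>\<^sub>F p in nhds \<eta>. (\<Sum>i\<in>I. f i (U i p)) = 0"
  shows "\<forall>\<^sub>F p in nhds \<eta>. (\<Sum>i\<in>I. g i (U i p)) = 0"
proof -
  have "\<forall>\<^sub>F p in nhds \<eta>. \<forall>i\<in>I. g i (U i p) = f i (U i p)"
  proof (intro eventually_ball_finite finite ballI)
    fix i assume i: "i \<in> I"
    have "filterlim (U i) (nhds (U i \<eta>)) (nhds \<eta>)"
      using continuous_at_center[OF i assms(1)] by (simp add: tendsto_at_iff_tendsto_nhds isCont_def)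
    then show "\<forall>\<^sub>F p in nhds \<eta>. g i (U i p) = f i (U i p)"
      by (rule eventually_compose_filterlim[OF ev[OF i]])
  qed
  with sum0 show ?thesis by eventually_elim simp
qed

lemma extend_step:
  assumes r: "r > 0" and sub: "cball \<eta> (stretch * r) \<subseteq> ball \<omega> \<rho>"
    and ext: "extends_to \<eta> f r"
    and sum0: "\<forall>\<^sub>F p in nhds \<eta>. (\<Sum>i\<in>I. f i (U i p)) = 0"
  shows "extends_to \<eta> f ((1 - \<epsilon>) * stretch * r)"
  unfolding extends_to_def
proof
  fix j assume j: "j \<in> I"
  obtain g where g: "\<And>i. i \<in> I \<Longrightarrow> g i holomorphic_on ball (U i \<eta>) (n i * r)"
    "\<And>i. i \<in> I \<Longrightarrow> \<forall>\<^sub>F w in nhds (U i \<eta>). g i w = f i w"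
    using ext unfolding extends_to_def by metis
  have "0 < stretch * r" using stretch(1) r by simp
  then have "\<eta> \<in> cball \<eta> (stretch * r)" by simp
  then have "\<eta> \<in> ball \<omega> \<rho>" using sub by blast
  from extend_step_one[OF j r sub g(1) sum_zero_cong[OF this g(2) sum0]]
  obtain g' where g': "g' holomorphic_on ball (U j \<eta>) (n j * ((1 - \<epsilon>) * stretch * r))"
    "\<forall>\<^sub>F w in nhds (U j \<eta>). g' w = g j w" by blast
  have "\<forall>\<^sub>F w in nhds (U j \<eta>). g' w = f j w"
    using g'(2) g(2)[OF j] by eventually_elim simp
  then show "\<exists>g. g holomorphic_on ball (U j \<eta>) (n j * ((1 - \<epsilon>) * stretch * r)) \<and>
      (\<forall>\<^sub>F w in nhds (U j \<eta>). g w = f j w)"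
    using g'(1) by blast
qed

lemma extends_to_mono:
  assumes "extends_to \<eta> f r" "s \<le> r"
  shows "extends_to \<eta> f s"
  unfolding extends_to_def
proof
  fix i assume i: "i \<in> I"
  have "ball (U i \<eta>) (n i * s) \<subseteq> ball (U i \<eta>) (n i * r)"
    using assms(2) n_pos[OF i] by (intro subset_ball) simp
  then show "\<exists>g. g holomorphic_on ball (U i \<eta>) (n i * s) \<and> (\<forall>\<^sub>F w in nhds (U i \<eta>). g w = f i w)"
    using assms(1) i holomorphic_on_subset unfolding extends_to_def by metis
qed

lemma extends_to_small:
  assumes "\<And>i. i \<in> I \<Longrightarrow> f i analytic_on {U i \<eta>}"
  shows "\<exists>r>0. extends_to \<eta> f r"
proof -
  have "\<forall>\<^sub>F r in at_right 0. \<forall>i\<in>I. f i holomorphic_on ball (U i \<eta>) (n i * r)"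
  proof (intro eventually_ball_finite finite ballI)
    fix i assume i: "i \<in> I"
    obtain d where d: "d > 0" "f i holomorphic_on ball (U i \<eta>) d"
      using assms[OF i] unfolding analytic_on_def by auto
    have "f i holomorphic_on ball (U i \<eta>) (n i * r)" if "r < d / n i" for r
      using that n_pos[OF i]
      by (intro holomorphic_on_subset[OF d(2)] subset_ball) (simp add: field_simps)
    then show "\<forall>\<^sub>F r in at_right 0. f i holomorphic_on ball (U i \<eta>) (n i * r)"
      unfolding eventually_at_right_field using d(1) n_pos[OF i]
      by (intro exI[of _ "d / n i"]) auto
  qed
  moreover have "\<forall>\<^sub>F r::real in at_right 0. r > 0" by (rule eventually_at_right_less)
  ultimately have "\<forall>\<^sub>F r in at_right 0. r > 0 \<and> (\<forall>i\<in>I. f i holomorphic_on ball (U i \<eta>) (n i * r))"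
    by eventually_elim auto
  from eventually_happens'[OF trivial_limit_at_right_real this]
  obtain r where "r > 0" "\<forall>i\<in>I. f i holomorphic_on ball (U i \<eta>) (n i * r)" by blast
  then show ?thesis unfolding extends_to_def by (intro exI[of _ r]) auto
qed

text \<open>
  Each step multiplies the radius by the fixed factor \<open>(1 - \<epsilon>) * stretch > 1\<close>. So however small
  the initial discs are, finitely many steps reach a radius \<open>R\<close> that depends only on the web.
\<close>

lemma extends_to_uniform:
  assumes an: "\<And>i. i \<in> I \<Longrightarrow> f i analytic_on {U i \<eta>}"
    and sum0: "\<forall>\<^sub>F p in nhds \<eta>. (\<Sum>i\<in>I. f i (U i p)) = 0"
    and R: "R > 0" "cball \<eta> (stretch * R) \<subseteq> ball \<omega> \<rho>"
  shows "extends_to \<eta> f R"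
proof -
  let ?\<mu> = "(1 - \<epsilon>) * stretch"
  obtain r0 where r0: "r0 > 0" "extends_to \<eta> f r0" using extends_to_small[OF an] by blast
  have "extends_to \<eta> f (min R (?\<mu> ^ m * r0))" for m
  proof (induction m)
    case 0
    show ?case using extends_to_mono[OF r0(2)] by simp
  next
    case (Suc m)
    let ?r = "min R (?\<mu> ^ m * r0)"
    have \<mu>: "1 < ?\<mu>" by (rule stretch(4))
    then have "0 < ?\<mu> ^ m" by (intro zero_less_power) linarith
    then have r: "0 < ?r" using R r0 by simp
    have "stretch * ?r \<le> stretch * R" using stretch(1) by (intro mult_left_mono) auto
    then have "cball \<eta> (stretch * ?r) \<subseteq> ball \<omega> \<rho>"
      using R(2) subset_cball by blast
    then have "extends_to \<eta> f (?\<mu> * ?r)"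
      by (rule extend_step[OF r _ Suc.IH sum0])
    moreover have "min R (?\<mu> ^ Suc m * r0) \<le> ?\<mu> * ?r"
    proof (cases "R \<le> ?\<mu> ^ m * r0")
      case True
      have "1 * R \<le> ?\<mu> * R" using \<mu> R(1) by (intro mult_right_mono) auto
      then show ?thesis using True by (simp add: min_def)
    next
      case False
      then have "?r = ?\<mu> ^ m * r0" by simp
      then show ?thesis by (simp add: mult.assoc)
    qed
    ultimately show ?case by (rule extends_to_mono)
  qed
  moreover obtain m where "R / r0 < ?\<mu> ^ m"
    using real_arch_pow[OF stretch(4)] by blast
  then have "R < ?\<mu> ^ m * r0" using r0(1) by (simp add: field_simps)
  ultimately show ?thesis by (metis less_imp_le min_absorb1)
qed

text \<open>
  The neighbourhood of \<open>\<omega>\<close> on which the solution lives is the same for all base points in it. The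
  radius of the discs around \<open>\<eta>\<close> is \<open>\<rho> / 8\<close>: since \<open>stretch < 4\<close>, the extension steps stay within
  \<open>\<rho> / 2\<close> of \<open>\<eta>\<close>. Two points of the smaller ball are at distance less than \<open>\<rho> / 16\<close>, so by
  \<open>lipschitz\<close> their values under \<open>U i\<close> differ by less than \<open>n i * (\<rho> / 8)\<close>. The sum vanishes
  there by the identity theorem on complex lines through \<open>\<eta>\<close>.
\<close>

lemma solution_extends:
  assumes \<eta>: "\<eta> \<in> ball \<omega> (\<rho> / 32)"
    and an: "\<And>i. i \<in> I \<Longrightarrow> f i analytic_on {U i \<eta>}"
    and sum0: "\<forall>\<^sub>F p in nhds \<eta>. (\<Sum>i\<in>I. f i (U i p)) = 0"
  shows "\<exists>g. (\<forall>i\<in>I. (\<forall>\<^sub>F w in nhds (U i \<eta>). g i w = f i w) \<and>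
      (\<forall>p\<in>ball \<omega> (\<rho> / 32). g i analytic_on {U i p})) \<and>
    (\<forall>p\<in>ball \<omega> (\<rho> / 32). (\<Sum>i\<in>I. g i (U i p)) = 0)"
proof -
  have near: "p \<in> ball \<omega> \<rho>" if "dist \<eta> p \<le> \<rho> / 2" for p
    using that \<eta> \<rho> dist_triangle[of \<omega> p \<eta>] by simp
  have \<eta>': "\<eta> \<in> ball \<omega> \<rho>" using near[of \<eta>] \<rho> by simp
  have "stretch * (\<rho> / 8) \<le> 4 * (\<rho> / 8)"
    using stretch(2) \<rho> by (intro mult_right_mono) auto
  then have "dist \<eta> p \<le> \<rho> / 2" if "p \<in> cball \<eta> (stretch * (\<rho> / 8))" for p
    using that unfolding mem_cball by linarith
  then have "cball \<eta> (stretch * (\<rho> / 8)) \<subseteq> ball \<omega> \<rho>"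
    using near by blast
  then have "extends_to \<eta> f (\<rho> / 8)" using \<rho> by (intro extends_to_uniform[OF an sum0]) auto
  then obtain g where g: "\<And>i. i \<in> I \<Longrightarrow> g i holomorphic_on ball (U i \<eta>) (n i * (\<rho> / 8))"
    "\<And>i. i \<in> I \<Longrightarrow> \<forall>\<^sub>F w in nhds (U i \<eta>). g i w = f i w"
    unfolding extends_to_def by metis
  have U_in: "U i p \<in> ball (U i \<eta>) (n i * (\<rho> / 8))" if i: "i \<in> I" and p: "dist \<eta> p < \<rho> / 16" for i p
  proof -
    have "norm (U i p - U i \<eta>) \<le> 2 * n i * norm (p - \<eta>)"
      using near[of p] p \<rho> by (intro lipschitz[OF i _ \<eta>']) auto
    also have "\<dots> < 2 * n i * (\<rho> / 16)"
      using p n_pos[OF i] by (intro mult_strict_left_mono) (auto simp: dist_norm norm_minus_commute)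
    finally show ?thesis by (simp add: dist_norm norm_minus_commute mult.commute)
  qed
  have close: "dist \<eta> p < \<rho> / 16" if "p \<in> ball \<omega> (\<rho> / 32)" for p
    using that \<eta> dist_triangle[of \<eta> p \<omega>] by (simp add: dist_commute)
  have "(\<Sum>i\<in>I. g i (U i p)) = 0" if p: "p \<in> ball \<omega> (\<rho> / 32)" for p
  proof -
    have sumg: "\<forall>\<^sub>F p in nhds \<eta>. (\<Sum>i\<in>I. g i (U i p)) = 0"
      by (rule sum_zero_cong[OF \<eta>' g(2) sum0])
    define w where "w = p - \<eta>"
    show ?thesis
    proof (cases "w = 0")
      case True
      then show ?thesis using eventually_nhds_x_imp_x[OF sumg] by (simp add: w_def)
    next
      case False
      let ?B = "ball 0 (\<rho> / 16 / norm w) :: complex set"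
      let ?p = "\<lambda>t. \<eta> + cscale t w"
      define \<phi> where "\<phi> = (\<lambda>t. \<Sum>i\<in>I. g i (U i (?p t)))"
      have pd: "dist \<eta> (?p t) < \<rho> / 16" if "t \<in> ?B" for t
        using that False by (simp add: dist_cscale field_simps)
      \<comment> \<open>Points of this disc give points of the line within \<open>\<rho> / 16\<close> of \<open>\<eta>\<close>; \<open>t = 1\<close> gives \<open>p\<close>.\<close>
      have holo\<phi>: "\<phi> holomorphic_on ?B"
        unfolding \<phi>_def
      proof (intro holomorphic_on_sum)
        fix i assume i: "i \<in> I"
        have "(\<lambda>t. U i (?p t)) holomorphic_on ?B"
        proof (rule holomorphic_on_subset[OF holo_line[OF i]])
          have "?p t \<in> ball \<omega> \<rho>" if "t \<in> ?B" for t
            using pd[OF that] \<rho> by (intro near) linarith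
          then show "?B \<subseteq> {t. ?p t \<in> ball \<omega> \<rho>}" by blast
        qed
        moreover have "(\<lambda>t. U i (?p t)) ` ?B \<subseteq> ball (U i \<eta>) (n i * (\<rho> / 8))"
          using U_in[OF i pd] by blast
        ultimately show "(\<lambda>t. g i (U i (?p t))) holomorphic_on ?B"
          using holomorphic_on_compose_gen[OF _ g(1)[OF i], of "\<lambda>t. U i (?p t)" ?B]
          by (simp only: o_def)
      qed
      have "\<forall>\<^sub>F t in nhds 0. \<phi> t = 0"
        unfolding \<phi>_def by (rule eventually_compose_filterlim[OF sumg tendsto_cscale_0])
      then obtain S where S: "open S" "0 \<in> S" "\<And>t. t \<in> S \<Longrightarrow> \<phi> t = 0"
        by (auto simp: eventually_nhds)
      have one: "1 \<in> ?B" using close[OF p] False by (simp add: w_def dist_norm norm_minus_commute)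
      have zero: "0 \<in> ?B" using \<rho> False by simp
      have "\<phi> 1 = 0"
      proof (rule analytic_continuation_open[of "S \<inter> ?B" ?B \<phi> "\<lambda>_. 0"])
        show "S \<inter> ?B \<noteq> {}" using S(2) zero by blast
      qed (use S holo\<phi> one in \<open>auto simp del: mem_ball\<close>)
      then show ?thesis by (simp add: \<phi>_def w_def)
    qed
  qed
  moreover have "g i analytic_on {U i p}" if "i \<in> I" "p \<in> ball \<omega> (\<rho> / 32)" for i p
    using g(1)[OF that(1)] U_in[OF that(1) close[OF that(2)]] by (meson analytic_at open_ball)
  ultimately show ?thesis using g(2) by blast
qed

end

text \<open>
  With \<open>a\<close> and \<open>b\<close> the coefficient vectors of two differentials, this is the Cauchy-Schwarz
  inequality with its defect: it is strict exactly when their wedge product does not vanish.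
\<close>

lemma lagrange_identity_complex:
  fixes a b :: "complex \<times> complex"
  shows "(norm (lin2 a (cnj (fst b), cnj (snd b))))\<^sup>2 + (norm (fst a * snd b - snd a * fst b))\<^sup>2
    = (norm a)\<^sup>2 * (norm b)\<^sup>2"
  by (simp add: lin2_def norm_prod_def cmod_power2) (simp add: power2_eq_square algebra_simps)

text \<open>
  The direction \<open>v i\<close> is the normalised conjugate gradient of \<open>U i\<close>. By the preceding identity
  \<open>\<bar>dU\<^sub>i(v j)\<bar> < n i\<close> for \<open>i \<noteq> j\<close>, and as there are finitely many pairs one \<open>\<epsilon>\<close> serves them all;
  \<open>\<rho>\<close> is then chosen so small that the nonlinear errors are at most \<open>\<epsilon> * n i\<close>. A margin of
  \<open>4 * \<epsilon>\<close> in the linear estimate becomes \<open>3 * \<epsilon>\<close> after this error.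
\<close>

lemma local_web_exists:
  assumes \<Omega>: "open \<Omega>" "\<omega> \<in> \<Omega>" and fin: "finite I"
    and U: "\<And>i. i \<in> I \<Longrightarrow> holo2_on (U i) (D i) \<Omega>"
    and nz: "\<And>i. i \<in> I \<Longrightarrow> D i \<omega> \<noteq> 0"
    and transverse: "\<And>i j. i \<in> I \<Longrightarrow> j \<in> I \<Longrightarrow> i \<noteq> j \<Longrightarrow>
      fst (D i \<omega>) * snd (D j \<omega>) - snd (D i \<omega>) * fst (D j \<omega>) \<noteq> 0"
  shows "\<exists>\<rho> \<epsilon> n v. local_web I U \<omega> \<rho> \<epsilon> n v"
proof -
  define n where "n = (\<lambda>i. norm (D i \<omega>))"
  define v where "v = (\<lambda>i. cscale (1 / n i) (cnj (fst (D i \<omega>)), cnj (snd (D i \<omega>))))"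
  have n_pos: "n i > 0" if "i \<in> I" for i using nz[OF that] by (simp add: n_def)
  have norm_cnj: "norm (cnj (fst b), cnj (snd b)) = norm b" for b
    by (simp add: norm_prod_def)
  have norm_v: "norm (v i) = 1" if "i \<in> I" for i
    using n_pos[OF that] by (simp add: v_def norm_cscale norm_cnj norm_divide) (simp add: n_def)
  have own: "lin2 (D i \<omega>) (v i) = n i" if "i \<in> I" for i
  proof -
    have "(n i)\<^sup>2 = (norm (fst (D i \<omega>)))\<^sup>2 + (norm (snd (D i \<omega>)))\<^sup>2"
      by (simp add: n_def norm_prod_def)
    then have "lin2 (D i \<omega>) (cnj (fst (D i \<omega>)), cnj (snd (D i \<omega>))) = complex_of_real ((n i)\<^sup>2)"
      by (simp only: lin2_def fst_conv snd_conv of_real_add complex_norm_square)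
    then show ?thesis
      using n_pos[OF that] by (simp add: v_def lin2_cscale power2_eq_square)
  qed
  have other: "norm (lin2 (D i \<omega>) (v j)) < n i" if ij: "i \<in> I" "j \<in> I" "i \<noteq> j" for i j
  proof -
    let ?l = "norm (lin2 (D i \<omega>) (cnj (fst (D j \<omega>)), cnj (snd (D j \<omega>))))"
    have "0 < (norm (fst (D i \<omega>) * snd (D j \<omega>) - snd (D i \<omega>) * fst (D j \<omega>)))\<^sup>2"
      using transverse[OF ij] by simp
    then have "?l\<^sup>2 < (n i * n j)\<^sup>2"
      using lagrange_identity_complex[of "D i \<omega>" "D j \<omega>"]
      unfolding n_def power_mult_distrib by linarith
    then have "?l < n i * n j"
      using n_pos[of i] n_pos[of j] ij by (intro power_less_imp_less_base[of ?l 2]) auto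
    then show ?thesis
      using n_pos[of j] ij by (simp add: v_def lin2_cscale norm_mult norm_divide field_simps)
  qed
  \<comment> \<open>Finitely many strict inequalities leave room for a common \<open>\<epsilon>\<close>.\<close>
  have "\<forall>\<^sub>F \<epsilon> in at_right 0. \<forall>i\<in>I. \<forall>j\<in>I. i \<noteq> j \<longrightarrow> norm (lin2 (D i \<omega>) (v j)) \<le> (1 - 4 * \<epsilon>) * n i"
  proof (intro eventually_ball_finite fin ballI)
    fix i j assume ij: "i \<in> I" "j \<in> I"
    have "((\<lambda>\<epsilon>. (1 - 4 * \<epsilon>) * n i) \<longlongrightarrow> (1 - 4 * 0) * n i) (at_right 0)"
      by (intro tendsto_intros)
    then have "\<forall>\<^sub>F \<epsilon> in at_right 0. norm (lin2 (D i \<omega>) (v j)) < (1 - 4 * \<epsilon>) * n i" if "i \<noteq> j"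
      using other[OF ij that] by (intro order_tendstoD(1)[where y = "(1 - 4 * 0) * n i"]) auto
    then show "\<forall>\<^sub>F \<epsilon> in at_right 0. i \<noteq> j \<longrightarrow> norm (lin2 (D i \<omega>) (v j)) \<le> (1 - 4 * \<epsilon>) * n i"
      by (cases "i = j") (auto elim: eventually_mono)
  qed
  moreover have "\<forall>\<^sub>F \<epsilon>::real in at_right 0. 0 < \<epsilon> \<and> \<epsilon> < 1 / 4"
    unfolding eventually_at_right_field by (intro exI[of _ "1 / 4"]) auto
  ultimately have "\<forall>\<^sub>F \<epsilon> in at_right 0. 0 < \<epsilon> \<and> \<epsilon> < 1 / 4 \<and>
      (\<forall>i\<in>I. \<forall>j\<in>I. i \<noteq> j \<longrightarrow> norm (lin2 (D i \<omega>) (v j)) \<le> (1 - 4 * \<epsilon>) * n i)"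
    by eventually_elim auto
  from eventually_happens'[OF trivial_limit_at_right_real this]
  obtain \<epsilon> where \<epsilon>: "0 < \<epsilon>" "\<epsilon> < 1 / 4" and
    small: "\<And>i j. i \<in> I \<Longrightarrow> j \<in> I \<Longrightarrow> i \<noteq> j \<Longrightarrow> norm (lin2 (D i \<omega>) (v j)) \<le> (1 - 4 * \<epsilon>) * n i"
    by blast
  have "\<forall>\<^sub>F \<rho> in at_right 0. \<forall>i\<in>I. ball \<omega> \<rho> \<subseteq> \<Omega> \<and>
    (\<forall>p\<in>ball \<omega> \<rho>. \<forall>q\<in>ball \<omega> \<rho>.
      norm (U i p - U i q - lin2 (D i \<omega>) (p - q)) \<le> (\<epsilon> * n i) * norm (p - q))"
    using \<epsilon> n_pos by (intro eventually_ball_finite fin ballI holo2_on_strict[OF \<Omega> U]) auto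
  moreover have "\<forall>\<^sub>F \<rho>::real in at_right 0. \<rho> > 0" by (rule eventually_at_right_less)
  ultimately have "\<forall>\<^sub>F \<rho> in at_right 0. \<rho> > 0 \<and> (\<forall>i\<in>I. ball \<omega> \<rho> \<subseteq> \<Omega> \<and>
    (\<forall>p\<in>ball \<omega> \<rho>. \<forall>q\<in>ball \<omega> \<rho>.
      norm (U i p - U i q - lin2 (D i \<omega>) (p - q)) \<le> (\<epsilon> * n i) * norm (p - q)))"
    by eventually_elim auto
  from eventually_happens'[OF trivial_limit_at_right_real this]
  obtain \<rho> where \<rho>: "\<rho> > 0" and sub: "\<And>i. i \<in> I \<Longrightarrow> ball \<omega> \<rho> \<subseteq> \<Omega>"
    and strict: "\<And>i p q. i \<in> I \<Longrightarrow> p \<in> ball \<omega> \<rho> \<Longrightarrow> q \<in> ball \<omega> \<rho> \<Longrightarrow>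
      norm (U i p - U i q - lin2 (D i \<omega>) (p - q)) \<le> \<epsilon> * n i * norm (p - q)"
    by blast
  have "local_web I U \<omega> \<rho> \<epsilon> n v"
  proof
    fix i assume i: "i \<in> I"
    show "(\<lambda>t. U i (\<eta> + cscale t w)) holomorphic_on {t. \<eta> + cscale t w \<in> ball \<omega> \<rho>}" for \<eta> w
      using holo2_on_line[OF \<Omega>(1) U[OF i]] by (rule holomorphic_on_subset) (use sub[OF i] in auto)
    show "norm (U i p - U i q) \<le> 2 * n i * norm (p - q)"
      if "p \<in> ball \<omega> \<rho>" "q \<in> ball \<omega> \<rho>" for p q
    proof -
      have "norm (U i p - U i q) \<le> norm (lin2 (D i \<omega>) (p - q)) + \<epsilon> * n i * norm (p - q)"
        using strict[OF i that] by (smt (verit) norm_triangle_ineq2)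
      also have "norm (lin2 (D i \<omega>) (p - q)) \<le> n i * norm (p - q)"
        unfolding n_def by (rule norm_lin2_le)
      also have "\<epsilon> * n i * norm (p - q) \<le> 1 * n i * norm (p - q)"
        using \<epsilon> n_pos[OF i] by (intro mult_right_mono) auto
      finally show ?thesis by simp
    qed
    show "norm (U i (\<eta> + cscale s (v i)) - U i (\<eta> + cscale t (v i)) - (s - t) * n i)
        \<le> \<epsilon> * n i * norm (s - t)"
      if "\<eta> + cscale s (v i) \<in> ball \<omega> \<rho>" "\<eta> + cscale t (v i) \<in> ball \<omega> \<rho>" for \<eta> s t
      using strict[OF i that] by (simp add: cscale_diff lin2_cscale norm_cscale own[OF i] norm_v[OF i])
    fix j assume j: "j \<in> I" "i \<noteq> j"
    show "norm (U i (\<eta> + cscale t (v j)) - U i \<eta>) \<le> (1 - 3 * \<epsilon>) * n i * norm t"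
      if "\<eta> \<in> ball \<omega> \<rho>" "\<eta> + cscale t (v j) \<in> ball \<omega> \<rho>" for \<eta> t
    proof -
      have "norm (U i (\<eta> + cscale t (v j)) - U i \<eta>)
          \<le> norm (t * lin2 (D i \<omega>) (v j)) + \<epsilon> * n i * norm t"
        using strict[OF i that(2,1)]
        by (simp add: lin2_cscale norm_cscale norm_v[OF j(1)]) (smt (verit) norm_triangle_ineq2)
      also have "norm (t * lin2 (D i \<omega>) (v j)) \<le> norm t * ((1 - 4 * \<epsilon>) * n i)"
        unfolding norm_mult using small[OF i j] by (intro mult_left_mono) auto
      finally show ?thesis by (simp add: algebra_simps)
    qed
  qed (use fin \<rho> \<epsilon> n_pos norm_v in auto)
  then show ?thesis by blast
qed

section \<open>Analytic continuation\<close>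

text \<open>
  For continuous \<open>c\<close> this is the local condition of \<open>continues_along\<close>, on an arbitrary
  parameter set and without explicit domains: the continuity of \<open>c\<close> keeps it in any neighbourhood of
  \<open>c t\<close> on which \<open>f\<close> is holomorphic.
\<close>

definition germ_family ::
  "(real \<Rightarrow> complex) \<Rightarrow> real set \<Rightarrow> (real \<Rightarrow> (complex \<Rightarrow> complex) set) \<Rightarrow> bool" where
  "germ_family c T G \<longleftrightarrow>
     (\<forall>t\<in>T. \<exists>f. f analytic_on {c t} \<and> (\<forall>\<^sub>F s in nhds t. s \<in> T \<longrightarrow> G s = germ_at (c s) f))"

definition continues_on ::
  "(real \<Rightarrow> complex) \<Rightarrow> real \<Rightarrow> real \<Rightarrow> (complex \<Rightarrow> complex) set \<Rightarrow> (complex \<Rightarrow> complex) set \<Rightarrow> bool"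
  where "continues_on c a b A B \<longleftrightarrow> (\<exists>G. germ_family c {a..b} G \<and> G a = A \<and> G b = B)"

lemma eventually_path_in_nhds:
  fixes c :: "real \<Rightarrow> complex"
  assumes "continuous_on T c" "t \<in> T" "\<forall>\<^sub>F w in nhds (c t). P w"
  shows "\<forall>\<^sub>F s in nhds t. s \<in> T \<longrightarrow> P (c s)"
proof -
  obtain W where W: "open W" "c t \<in> W" "\<And>w. w \<in> W \<Longrightarrow> P w"
    using assms(3) by (auto simp: eventually_nhds)
  then have "\<exists>A. open A \<and> t \<in> A \<and> (\<forall>y\<in>T. y \<in> A \<longrightarrow> c y \<in> W)"
    using assms(1,2) unfolding continuous_on_topological by blast
  then show ?thesis using W unfolding eventually_nhds by blast
qed

lemma continues_along_iff:
  assumes "continuous_on {0..1} c"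
  shows "continues_along c A B \<longleftrightarrow> continues_on c 0 1 A B"
proof -
  have "(\<exists>f V. open V \<and> c t \<in> V \<and> f holomorphic_on V \<and>
           (\<exists>\<delta>>0. \<forall>s\<in>{0..1}. \<bar>s - t\<bar> < \<delta> \<longrightarrow> c s \<in> V \<and> G s = germ_at (c s) f)) \<longleftrightarrow>
        (\<exists>f. f analytic_on {c t} \<and> (\<forall>\<^sub>F s in nhds t. s \<in> {0..1} \<longrightarrow> G s = germ_at (c s) f))"
    (is "?L \<longleftrightarrow> ?R") if t: "t \<in> {0..1}" for t G
  proof
    assume ?L
    then show ?R
      unfolding eventually_nhds_metric dist_real_def analytic_at by meson
  next
    assume ?R
    then obtain f where f: "f analytic_on {c t}"
      "\<forall>\<^sub>F s in nhds t. s \<in> {0..1} \<longrightarrow> G s = germ_at (c s) f" by blast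
    then obtain V where V: "open V" "c t \<in> V" "f holomorphic_on V"
      by (auto simp: analytic_at)
    have "\<forall>\<^sub>F s in nhds t. s \<in> {0..1} \<longrightarrow> c s \<in> V"
      using V by (intro eventually_path_in_nhds[OF assms t] eventually_nhds_in_open)
    with f(2) have "\<forall>\<^sub>F s in nhds t. s \<in> {0..1} \<longrightarrow> c s \<in> V \<and> G s = germ_at (c s) f"
      by eventually_elim auto
    then obtain \<delta> where "\<delta> > 0" "\<forall>s. \<bar>s - t\<bar> < \<delta> \<longrightarrow> s \<in> {0..1} \<longrightarrow> c s \<in> V \<and> G s = germ_at (c s) f"
      unfolding eventually_nhds_metric dist_real_def by blast
    then show ?L using V by blast
  qed
  then show ?thesis
    unfolding continues_along_def continues_on_def germ_family_def by (intro ex_cong1) auto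
qed

text \<open>
  At the junction \<open>b\<close> the functions representing the two families have the same germ at
  \<open>c b\<close>, hence the same germs at all nearby points, and either of them represents both families.
\<close>

lemma continues_on_trans:
  assumes c: "continuous_on {a..d} c" and "a \<le> b" "b \<le> d"
    and "continues_on c a b A B" "continues_on c b d B C"
  shows "continues_on c a d A C"
proof -
  from assms obtain G H where G: "germ_family c {a..b} G" "G a = A" "G b = B"
    and H: "germ_family c {b..d} H" "H b = B" "H d = C"
    unfolding continues_on_def by blast
  define K where "K = (\<lambda>s. if s \<le> b then G s else H s)"
  have "\<exists>f. f analytic_on {c t} \<and> (\<forall>\<^sub>F s in nhds t. s \<in> {a..d} \<longrightarrow> K s = germ_at (c s) f)"
    if t: "t \<in> {a..d}" for t
  proof -
    consider "t < b" | "t = b" | "t > b" by linarith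
    then show ?thesis
    proof cases
      case 1
      then obtain f where f: "f analytic_on {c t}"
        "\<forall>\<^sub>F s in nhds t. s \<in> {a..b} \<longrightarrow> G s = germ_at (c s) f"
        using bspec[OF G(1)[unfolded germ_family_def], of t] t by auto
      have "\<forall>\<^sub>F s in nhds t. s < b" using 1 by (rule eventually_nhds_in_open[of "{..<b}", simplified])
      with f(2) have "\<forall>\<^sub>F s in nhds t. s \<in> {a..d} \<longrightarrow> K s = germ_at (c s) f"
        by eventually_elim (auto simp: K_def)
      then show ?thesis using f(1) by blast
    next
      case 3
      then obtain f where f: "f analytic_on {c t}"
        "\<forall>\<^sub>F s in nhds t. s \<in> {b..d} \<longrightarrow> H s = germ_at (c s) f"
        using bspec[OF H(1)[unfolded germ_family_def], of t] t by auto
      have "\<forall>\<^sub>F s in nhds t. s > b" using 3 by (rule eventually_nhds_in_open[of "{b<..}", simplified])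
      with f(2) have "\<forall>\<^sub>F s in nhds t. s \<in> {a..d} \<longrightarrow> K s = germ_at (c s) f"
        by eventually_elim (auto simp: K_def)
      then show ?thesis using f(1) by blast
    next
      case 2
      obtain f where f: "f analytic_on {c b}"
        "\<forall>\<^sub>F s in nhds b. s \<in> {a..b} \<longrightarrow> G s = germ_at (c s) f"
        using bspec[OF G(1)[unfolded germ_family_def], of b] assms(2) by auto
      obtain h where h: "\<forall>\<^sub>F s in nhds b. s \<in> {b..d} \<longrightarrow> H s = germ_at (c s) h"
        using bspec[OF H(1)[unfolded germ_family_def], of b] assms(3) by auto
      have "germ_at (c b) f = B"
        using eventually_nhds_x_imp_x[OF f(2)] G(3) assms(2) by simp
      moreover have "germ_at (c b) h = B"
        using eventually_nhds_x_imp_x[OF h] H(2) assms(3) by simp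
      ultimately have "\<forall>\<^sub>F w in nhds (c b). f w = h w"
        using germ_at_eq_iff by metis
      then have "\<forall>\<^sub>F v in nhds (c b). germ_at v f = germ_at v h"
        by (simp add: germ_at_eq_iff eventually_eventually)
      then have "\<forall>\<^sub>F s in nhds b. s \<in> {a..d} \<longrightarrow> germ_at (c s) f = germ_at (c s) h"
        using t 2 by (intro eventually_path_in_nhds[OF c]) auto
      with f(2) h have "\<forall>\<^sub>F s in nhds b. s \<in> {a..d} \<longrightarrow> K s = germ_at (c s) f"
        by eventually_elim (auto simp: K_def)
      then show ?thesis using f(1) 2 by blast
    qed
  qed
  moreover have "K a = A" "K d = C"
    using assms(2,3) G H by (auto simp: K_def)
  ultimately show ?thesis unfolding continues_on_def germ_family_def by blast
qed

text \<open>
  The identity theorem on a disc around \<open>z\<close>, as a statement about germs.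
\<close>

lemma germs_eq_nearby:
  assumes "f analytic_on {z}" "g analytic_on {z}"
  shows "\<forall>\<^sub>F w in nhds z. germ_at w f = germ_at w g \<longleftrightarrow> germ_at z f = germ_at z g"
proof -
  obtain r where r: "r > 0" "f holomorphic_on ball z r" "g holomorphic_on ball z r"
  proof -
    obtain r1 r2 where "r1 > 0" "f holomorphic_on ball z r1" "r2 > 0" "g holomorphic_on ball z r2"
      using assms unfolding analytic_on_def by blast
    then show ?thesis
      by (intro that[of "min r1 r2"]) (auto intro: holomorphic_on_subset)
  qed
  have "f u = g u" if w: "w \<in> ball z r" and ev: "\<forall>\<^sub>F w in nhds w. f w = g w" and u: "u \<in> ball z r"
    for w u
  proof -
    obtain S where S: "open S" "w \<in> S" "\<And>x. x \<in> S \<Longrightarrow> f x = g x"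
      using ev by (auto simp: eventually_nhds)
    show ?thesis
      by (rule analytic_continuation_open[of "S \<inter> ball z r" "ball z r" f g])
        (use S w u r in auto)
  qed
  note same = this
  have "(\<forall>\<^sub>F w in nhds u. f w = g w) \<longleftrightarrow> (\<forall>w\<in>ball z r. f w = g w)"
    if u: "u \<in> ball z r" for u
  proof
    assume "\<forall>\<^sub>F w in nhds u. f w = g w"
    then show "\<forall>w\<in>ball z r. f w = g w" using same[OF u] by blast
  next
    assume eq: "\<forall>w\<in>ball z r. f w = g w"
    have "\<forall>\<^sub>F w in nhds u. w \<in> ball z r"
      by (rule eventually_nhds_in_open[OF open_ball u])
    then show "\<forall>\<^sub>F w in nhds u. f w = g w"
      by eventually_elim (use eq in blast)
  qed
  then have "germ_at w f = germ_at w g \<longleftrightarrow> germ_at z f = germ_at z g" if "w \<in> ball z r" for w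
    unfolding germ_at_eq_iff using that r(1) by simp
  moreover have "\<forall>\<^sub>F w in nhds z. w \<in> ball z r"
    by (rule eventually_nhds_in_open) (use r(1) in auto)
  ultimately show ?thesis
    by (rule eventually_mono[rotated])
qed

text \<open>
  By the identity theorem, whether two families agree at \<open>t\<close> is a locally constant property of \<open>t\<close>.
  The two directions give uniqueness of the continuation and injectivity in the initial germ.
\<close>

lemma germ_family_eq_iff:
  assumes c: "continuous_on {a..b} c" and "a \<le> b"
    and G: "germ_family c {a..b} G" and H: "germ_family c {a..b} H"
  shows "G a = H a \<longleftrightarrow> G b = H b"
proof -
  define P where "P = (\<lambda>u v. u \<in> {a..b} \<longrightarrow> v \<in> {a..b} \<longrightarrow> (G u = H u \<longleftrightarrow> G v = H v))"
  have "P a b"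
  proof (rule Bolzano[OF \<open>a \<le> b\<close>])
    fix x y z assume "P x y" "P y z" "x \<le> y" "y \<le> z"
    then show "P x z" unfolding P_def by auto
  next
    fix x assume "a \<le> x" "x \<le> b"
    then have x: "x \<in> {a..b}" by simp
    obtain f where f: "f analytic_on {c x}" "\<forall>\<^sub>F s in nhds x. s \<in> {a..b} \<longrightarrow> G s = germ_at (c s) f"
      using G x unfolding germ_family_def by blast
    obtain h where h: "h analytic_on {c x}" "\<forall>\<^sub>F s in nhds x. s \<in> {a..b} \<longrightarrow> H s = germ_at (c s) h"
      using H x unfolding germ_family_def by blast
    have "\<forall>\<^sub>F s in nhds x. s \<in> {a..b} \<longrightarrow>
        (germ_at (c s) f = germ_at (c s) h \<longleftrightarrow> germ_at (c x) f = germ_at (c x) h)"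
      by (rule eventually_path_in_nhds[OF c x germs_eq_nearby[OF f(1) h(1)]])
    with f(2) h(2) have "\<forall>\<^sub>F s in nhds x. s \<in> {a..b} \<longrightarrow>
        (G s = H s \<longleftrightarrow> germ_at (c x) f = germ_at (c x) h)"
      by eventually_elim auto
    then obtain d where d: "d > 0" "\<And>s. \<bar>s - x\<bar> < d \<Longrightarrow> s \<in> {a..b} \<Longrightarrow>
        (G s = H s \<longleftrightarrow> germ_at (c x) f = germ_at (c x) h)"
      unfolding eventually_nhds_metric dist_real_def by blast
    have "P u v" if "u \<le> x" "x \<le> v" "v - u < d" for u v
      using d(2)[of u] d(2)[of v] that unfolding P_def by auto
    then show "\<exists>d>0. \<forall>u v. u \<le> x \<and> x \<le> v \<and> v - u < d \<longrightarrow> P u v"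
      using d(1) by blast
  qed
  then show ?thesis using \<open>a \<le> b\<close> by (simp add: P_def)
qed

lemma continues_on_unique:
  assumes "continuous_on {a..b} c" "a \<le> b" "continues_on c a b A B" "continues_on c a b A' B'"
  shows "A = A' \<longleftrightarrow> B = B'"
  using assms germ_family_eq_iff unfolding continues_on_def by metis

lemma continues_on_add:
  assumes "continues_on c a b A B" "continues_on c a b A' B'"
  shows "continues_on c a b (germ_add (c a) A A') (germ_add (c b) B B')"
proof -
  from assms obtain G H where G: "germ_family c {a..b} G" "G a = A" "G b = B"
    and H: "germ_family c {a..b} H" "H a = A'" "H b = B'"
    unfolding continues_on_def by blast
  have "germ_family c {a..b} (\<lambda>t. germ_add (c t) (G t) (H t))"
    unfolding germ_family_def
  proof
    fix t assume t: "t \<in> {a..b}"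
    obtain f where f: "f analytic_on {c t}" "\<forall>\<^sub>F s in nhds t. s \<in> {a..b} \<longrightarrow> G s = germ_at (c s) f"
      using G t unfolding germ_family_def by blast
    obtain h where h: "h analytic_on {c t}" "\<forall>\<^sub>F s in nhds t. s \<in> {a..b} \<longrightarrow> H s = germ_at (c s) h"
      using H t unfolding germ_family_def by blast
    have "\<forall>\<^sub>F s in nhds t. s \<in> {a..b} \<longrightarrow> germ_add (c s) (G s) (H s) = germ_at (c s) (\<lambda>w. f w + h w)"
      using f(2) h(2) by eventually_elim (auto simp: germ_add_germ_at)
    then show "\<exists>f. f analytic_on {c t} \<and>
        (\<forall>\<^sub>F s in nhds t. s \<in> {a..b} \<longrightarrow> germ_add (c s) (G s) (H s) = germ_at (c s) f)"
      using f(1) h(1) by (intro exI[of _ "\<lambda>w. f w + h w"]) (auto intro: analytic_intros)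
  qed
  then show ?thesis using G H unfolding continues_on_def by blast
qed

lemma continues_on_scale:
  assumes "continues_on c a b A B"
  shows "continues_on c a b (germ_scale (c a) k A) (germ_scale (c b) k B)"
proof -
  from assms obtain G where G: "germ_family c {a..b} G" "G a = A" "G b = B"
    unfolding continues_on_def by blast
  have "germ_family c {a..b} (\<lambda>t. germ_scale (c t) k (G t))"
    unfolding germ_family_def
  proof
    fix t assume t: "t \<in> {a..b}"
    obtain f where f: "f analytic_on {c t}" "\<forall>\<^sub>F s in nhds t. s \<in> {a..b} \<longrightarrow> G s = germ_at (c s) f"
      using G t unfolding germ_family_def by blast
    have "\<forall>\<^sub>F s in nhds t. s \<in> {a..b} \<longrightarrow> germ_scale (c s) k (G s) = germ_at (c s) (\<lambda>w. k * f w)"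
      using f(2) by eventually_elim (auto simp: germ_scale_germ_at)
    then show "\<exists>f. f analytic_on {c t} \<and>
        (\<forall>\<^sub>F s in nhds t. s \<in> {a..b} \<longrightarrow> germ_scale (c s) k (G s) = germ_at (c s) f)"
      using f(1) by (intro exI[of _ "\<lambda>w. k * f w"]) (auto intro: analytic_intros)
  qed
  then show ?thesis using G unfolding continues_on_def by blast
qed

section \<open>The nine web functions\<close>

lemma index_cases:
  assumes "i \<in> {1..9::nat}"
  shows "i = 1 \<or> i = 2 \<or> i = 3 \<or> i = 4 \<or> i = 5 \<or> i = 6 \<or> i = 7 \<or> i = 8 \<or> i = 9"
  using assms by auto

lemma holo2_webU_num:
  assumes "i \<in> {1..9}"
  shows "\<exists>D. holo2_on (webU_num i) D \<Omega>"
  using index_cases[OF assms]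
  unfolding webU_num_def case_prod_beta
  by (elim disjE) (simp add: power2_eq_square, rule exI,
      (rule holo2_on_const holo2_on_fst holo2_on_snd holo2_on_diff holo2_on_mult)+)+

lemma holo2_webU_den:
  assumes "i \<in> {1..9}"
  shows "\<exists>D. holo2_on (webU_den i) D \<Omega>"
  using index_cases[OF assms]
  unfolding webU_den_def case_prod_beta
  by (elim disjE) (simp add: power2_eq_square, rule exI,
      (rule holo2_on_const holo2_on_fst holo2_on_snd holo2_on_diff holo2_on_mult)+)+

lemma open_regular: "open (- polar_locus)"
proof -
  have "closed {p. webU_den i p = 0}" if "i \<in> {1..9}" for i
  proof -
    obtain D where "holo2_on (webU_den i) D UNIV" using holo2_webU_den[OF \<open>i \<in> _\<close>] by blast
    from holo2_on_continuous[OF this] show ?thesis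
      by (intro closed_Collect_eq) auto
  qed
  then show ?thesis unfolding polar_locus_def open_closed by auto
qed

lemma holo2_webU:
  assumes "i \<in> {1..9}"
  shows "\<exists>D. holo2_on (webU i) D (- polar_locus)"
proof -
  obtain D E where "holo2_on (webU_num i) D (- polar_locus)" "holo2_on (webU_den i) E (- polar_locus)"
    using holo2_webU_num holo2_webU_den assms by metis
  moreover have "webU_den i p \<noteq> 0" if "p \<in> - polar_locus" for p
    using that assms by (auto simp: polar_locus_def)
  ultimately show ?thesis
    using holo2_on_divide unfolding webU_def[abs_def] by blast
qed

lemma continuous_webU: "i \<in> {1..9} \<Longrightarrow> continuous_on (- polar_locus) (webU i)"
  using holo2_webU holo2_on_continuous by blast

lemma wedge_lin2:
  "wedge (lin2 a) (lin2 b)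
    = (\<lambda>v w. (fst a * snd b - snd a * fst b) * (fst v * snd w - snd v * fst w))"
  by (simp add: wedge_def lin2_def fun_eq_iff algebra_simps)

lemma webU_transverse:
  assumes \<omega>: "\<omega> \<notin> singular_locus" and D: "\<And>i. i \<in> {1..9} \<Longrightarrow> holo2_on (webU i) (D i) (- polar_locus)"
    and ij: "i \<in> {1..9}" "j \<in> {1..9}" "i \<noteq> j"
  shows "fst (D i \<omega>) * snd (D j \<omega>) - snd (D i \<omega>) * fst (D j \<omega>) \<noteq> 0"
proof -
  have reg: "\<omega> \<in> - polar_locus" using \<omega> by (simp add: singular_locus_def)
  have fd: "frechet_derivative (webU i) (at \<omega>) = lin2 (D i \<omega>)" if "i \<in> {1..9}" for i
    using D[OF that] reg frechet_derivative_at by (fastforce simp: holo2_on_def)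
  have less: "fst (D i \<omega>) * snd (D j \<omega>) - snd (D i \<omega>) * fst (D j \<omega>) \<noteq> 0"
    if "i \<in> {1..9}" "j \<in> {1..9}" "i < j" for i j
  proof
    assume "fst (D i \<omega>) * snd (D j \<omega>) - snd (D i \<omega>) * fst (D j \<omega>) = 0"
    then have "wedge (frechet_derivative (webU i) (at \<omega>)) (frechet_derivative (webU j) (at \<omega>))
        = (\<lambda>v w. 0)"
      using that by (simp add: fd wedge_lin2)
    then have "\<omega> \<in> singular_locus"
      unfolding singular_locus_def using that by blast
    with \<omega> show False by simp
  qed
  show ?thesis
    using less[of i j] less[of j i] ij by (cases "i < j") (auto simp: algebra_simps)
qed

text \<open>
  Although the germs of a solution at \<open>\<eta>\<close> may have very small domains, a radius \<open>R\<close> depending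
  only on \<open>\<omega>\<close> is enough to extend all of them.
\<close>

lemma solutions_extend:
  assumes \<omega>: "\<omega> \<notin> singular_locus"
  shows "\<exists>R>0. \<forall>\<eta>\<in>ball \<omega> R. \<forall>F\<in>solutions \<eta>. \<exists>f. F = (\<lambda>i\<in>{1..9}. germ_at (webU i \<eta>) (f i)) \<and>
    (\<forall>i\<in>{1..9}. \<forall>p\<in>ball \<omega> R. f i analytic_on {webU i p}) \<and>
    (\<forall>p\<in>ball \<omega> R. (\<Sum>i=1..9. f i (webU i p)) = 0)"
proof -
  obtain D where D: "\<And>i. i \<in> {1..9} \<Longrightarrow> holo2_on (webU i) (D i) (- polar_locus)"
    using holo2_webU by metis
  have tr: "fst (D i \<omega>) * snd (D j \<omega>) - snd (D i \<omega>) * fst (D j \<omega>) \<noteq> 0"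
    if "i \<in> {1..9}" "j \<in> {1..9}" "i \<noteq> j" for i j
    by (rule webU_transverse[OF \<omega> D that])
  have "D i \<omega> \<noteq> 0" if "i \<in> {1..9}" for i
  proof -
    obtain j where "j \<in> {1..9::nat}" "i \<noteq> j"
      by (cases "i = 1") (use that in \<open>auto intro: that[of 1] that[of 2]\<close>)
    from tr[OF \<open>i \<in> _\<close> this] show ?thesis by auto
  qed
  note nz = this
  have "\<omega> \<in> - polar_locus" using \<omega> by (simp add: singular_locus_def)
  have "\<exists>\<rho> \<epsilon> n v. local_web {1..9} webU \<omega> \<rho> \<epsilon> n v"
    by (rule local_web_exists[OF open_regular \<open>\<omega> \<in> - polar_locus\<close> finite_atLeastAtMost])
      (fact D nz tr)+
  then obtain \<rho> \<epsilon> n v where "local_web {1..9} webU \<omega> \<rho> \<epsilon> n v"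
    by blast
  then interpret local_web "{1..9}" webU \<omega> \<rho> \<epsilon> n v .
  show ?thesis
  proof (intro exI[of _ "\<rho> / 32"] conjI ballI)
    show "0 < \<rho> / 32" using \<rho> by simp
    fix \<eta> F assume \<eta>: "\<eta> \<in> ball \<omega> (\<rho> / 32)" and F: "F \<in> solutions \<eta>"
    from F obtain f where f: "F = (\<lambda>i\<in>{1..9}. germ_at (webU i \<eta>) (f i))"
      "\<And>i. i \<in> {1..9} \<Longrightarrow> f i analytic_on {webU i \<eta>}"
      "\<forall>\<^sub>F p in nhds \<eta>. (\<Sum>i=1..9. f i (webU i p)) = 0"
      by (rule solutionsE) blast
    from solution_extends[OF \<eta> f(2,3)] obtain g where
      g: "\<And>i. i \<in> {1..9} \<Longrightarrow> \<forall>\<^sub>F w in nhds (webU i \<eta>). g i w = f i w"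
      "\<And>i p. i \<in> {1..9} \<Longrightarrow> p \<in> ball \<omega> (\<rho> / 32) \<Longrightarrow> g i analytic_on {webU i p}"
      "\<And>p. p \<in> ball \<omega> (\<rho> / 32) \<Longrightarrow> (\<Sum>i=1..9. g i (webU i p)) = 0"
      by blast
    have "germ_at (webU i \<eta>) (g i) = germ_at (webU i \<eta>) (f i)" if "i \<in> {1..9}" for i
      using g(1)[OF that] by (simp add: germ_at_eq_iff)
    then have "F = (\<lambda>i\<in>{1..9}. germ_at (webU i \<eta>) (g i))"
      unfolding f(1) by (intro restrict_ext) simp
    then show "\<exists>f. F = (\<lambda>i\<in>{1..9}. germ_at (webU i \<eta>) (f i)) \<and>
      (\<forall>i\<in>{1..9}. \<forall>p\<in>ball \<omega> (\<rho> / 32). f i analytic_on {webU i p}) \<and>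
      (\<forall>p\<in>ball \<omega> (\<rho> / 32). (\<Sum>i=1..9. f i (webU i p)) = 0)"
      using g(2,3) by blast
  qed
qed

section \<open>Transport of solutions along a path\<close>

lemma continues_on_single_function:
  assumes "u \<le> v" "\<And>t. t \<in> {u..v} \<Longrightarrow> f analytic_on {c t}"
  shows "continues_on c u v (germ_at (c u) f) (germ_at (c v) f)"
proof -
  have "germ_family c {u..v} (\<lambda>t. germ_at (c t) f)"
    unfolding germ_family_def
  proof
    fix t assume "t \<in> {u..v}"
    then show "\<exists>g. g analytic_on {c t} \<and>
        (\<forall>\<^sub>F s in nhds t. s \<in> {u..v} \<longrightarrow> germ_at (c s) f = germ_at (c s) g)"
      using assms(2) by (intro exI[of _ f]) simp
  qed
  then show ?thesis unfolding continues_on_def by blast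
qed

definition transports ::
  "(real \<Rightarrow> complex \<times> complex) \<Rightarrow> real \<Rightarrow> real \<Rightarrow> (nat \<Rightarrow> (complex \<Rightarrow> complex) set) \<Rightarrow>
    (nat \<Rightarrow> (complex \<Rightarrow> complex) set) \<Rightarrow> bool" where
  "transports \<gamma> u v F H \<longleftrightarrow> (\<forall>i\<in>{1..9}. continues_on (webU i \<circ> \<gamma>) u v (F i) (H i))"

text \<open>
  Within a ball of uniform extension a solution given at any parameter \<open>s\<close> comes from functions
  defined along the whole piece of path, so it can be transported to both ends.
\<close>

lemma transports_locally:
  assumes "u \<le> v" "s \<in> {u..v}" and sub: "\<gamma> ` {u..v} \<subseteq> ball \<omega> R" and F: "F \<in> solutions (\<gamma> s)"
    and ext: "\<forall>\<eta>\<in>ball \<omega> R. \<forall>F\<in>solutions \<eta>. \<exists>f. F = (\<lambda>i\<in>{1..9}. germ_at (webU i \<eta>) (f i)) \<and>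
      (\<forall>i\<in>{1..9}. \<forall>p\<in>ball \<omega> R. f i analytic_on {webU i p}) \<and>
      (\<forall>p\<in>ball \<omega> R. (\<Sum>i=1..9. f i (webU i p)) = 0)"
  shows "\<exists>G. G s = F \<and> (\<forall>t\<in>{u..v}. G t \<in> solutions (\<gamma> t)) \<and> transports \<gamma> u v (G u) (G v)"
proof -
  have "\<gamma> s \<in> ball \<omega> R" using sub assms(2) by blast
  with ext F obtain f where f: "F = (\<lambda>i\<in>{1..9}. germ_at (webU i (\<gamma> s)) (f i))"
    "\<And>i p. i \<in> {1..9} \<Longrightarrow> p \<in> ball \<omega> R \<Longrightarrow> f i analytic_on {webU i p}"
    "\<And>p. p \<in> ball \<omega> R \<Longrightarrow> (\<Sum>i=1..9. f i (webU i p)) = 0"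
    by blast
  define G where "G = (\<lambda>t. \<lambda>i\<in>{1..9}. germ_at (webU i (\<gamma> t)) (f i))"
  have "G t \<in> solutions (\<gamma> t)" if "t \<in> {u..v}" for t
    unfolding G_def
  proof (rule solutionsI)
    have "\<gamma> t \<in> ball \<omega> R" using sub that by blast
    then show "f i analytic_on {webU i (\<gamma> t)}" if "i \<in> {1..9}" for i using f(2) that by blast
    have "\<forall>\<^sub>F p in nhds (\<gamma> t). p \<in> ball \<omega> R"
      by (rule eventually_nhds_in_open) (use \<open>\<gamma> t \<in> ball \<omega> R\<close> in auto)
    then show "\<forall>\<^sub>F p in nhds (\<gamma> t). (\<Sum>i=1..9. f i (webU i p)) = 0"
      by eventually_elim (rule f(3))
  qed
  moreover have "transports \<gamma> u v (G u) (G v)"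
    unfolding transports_def
  proof
    fix i :: nat assume i: "i \<in> {1..9}"
    have "f i analytic_on {(webU i \<circ> \<gamma>) t}" if "t \<in> {u..v}" for t
      using f(2)[OF i, of "\<gamma> t"] sub that unfolding o_def by blast
    then have "continues_on (webU i \<circ> \<gamma>) u v
        (germ_at ((webU i \<circ> \<gamma>) u) (f i)) (germ_at ((webU i \<circ> \<gamma>) v) (f i))"
      by (rule continues_on_single_function[OF \<open>u \<le> v\<close>])
    then show "continues_on (webU i \<circ> \<gamma>) u v (G u i) (G v i)" using i by (simp add: G_def)
  qed
  moreover have "G s = F" by (simp add: G_def f(1))
  ultimately show ?thesis by blast
qed

lemma continuous_webU_path:
  assumes "continuous_on T \<gamma>" "\<gamma> ` T \<subseteq> - singular_locus" "i \<in> {1..9}"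
  shows "continuous_on T (webU i \<circ> \<gamma>)"
proof -
  have "\<gamma> ` T \<subseteq> - polar_locus" using assms(2) by (auto simp: singular_locus_def)
  then show ?thesis
    using assms(1) continuous_webU[OF assms(3)]
    by (intro continuous_on_compose) (auto intro: continuous_on_subset)
qed

lemma transports_trans:
  assumes "continuous_on {a..d} \<gamma>" "\<gamma> ` {a..d} \<subseteq> - singular_locus" "a \<le> b" "b \<le> d"
    "transports \<gamma> a b F G" "transports \<gamma> b d G H"
  shows "transports \<gamma> a d F H"
  using assms continues_on_trans[OF continuous_webU_path[OF assms(1,2)] assms(3,4)]
  unfolding transports_def by blast

text \<open>
  Solutions can be transported in both directions. By bisection this reduces to short pieces of
  the path, each inside one ball of uniform extension.
\<close>

lemma transports_exist:
  assumes "a \<le> b" and \<gamma>: "continuous_on {a..b} \<gamma>" "\<gamma> ` {a..b} \<subseteq> - singular_locus"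
  shows "(\<forall>F\<in>solutions (\<gamma> a). \<exists>H\<in>solutions (\<gamma> b). transports \<gamma> a b F H) \<and>
         (\<forall>H\<in>solutions (\<gamma> b). \<exists>F\<in>solutions (\<gamma> a). transports \<gamma> a b F H)"
proof -
  define P where "P = (\<lambda>u v. u \<in> {a..b} \<longrightarrow> v \<in> {a..b} \<longrightarrow>
     (\<forall>F\<in>solutions (\<gamma> u). \<exists>H\<in>solutions (\<gamma> v). transports \<gamma> u v F H) \<and>
     (\<forall>H\<in>solutions (\<gamma> v). \<exists>F\<in>solutions (\<gamma> u). transports \<gamma> u v F H))"
  have "P a b"
  proof (rule Bolzano[OF \<open>a \<le> b\<close>])
    fix x y z assume P: "P x y" "P y z" and le: "x \<le> y" "y \<le> z"
    show "P x z"
      unfolding P_def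
    proof (rule impI, rule impI)
      assume xz: "x \<in> {a..b}" "z \<in> {a..b}"
      then have y: "y \<in> {a..b}" and sub: "{x..z} \<subseteq> {a..b}" using le by auto
      have tr: "transports \<gamma> x z F H" if "transports \<gamma> x y F G" "transports \<gamma> y z G H" for F G H
        using transports_trans[OF _ _ le that] continuous_on_subset[OF \<gamma>(1) sub] \<gamma>(2) sub by blast
      have Pxy: "(\<forall>F\<in>solutions (\<gamma> x). \<exists>H\<in>solutions (\<gamma> y). transports \<gamma> x y F H)"
          "(\<forall>H\<in>solutions (\<gamma> y). \<exists>F\<in>solutions (\<gamma> x). transports \<gamma> x y F H)"
        and Pyz: "(\<forall>F\<in>solutions (\<gamma> y). \<exists>H\<in>solutions (\<gamma> z). transports \<gamma> y z F H)"
          "(\<forall>H\<in>solutions (\<gamma> z). \<exists>F\<in>solutions (\<gamma> y). transports \<gamma> y z F H)"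
        using P xz y unfolding P_def by blast+
      show "(\<forall>F\<in>solutions (\<gamma> x). \<exists>H\<in>solutions (\<gamma> z). transports \<gamma> x z F H) \<and>
          (\<forall>H\<in>solutions (\<gamma> z). \<exists>F\<in>solutions (\<gamma> x). transports \<gamma> x z F H)"
        using Pxy Pyz tr by meson
    qed
  next
    fix x assume x: "a \<le> x" "x \<le> b"
    then have "\<gamma> x \<in> \<gamma> ` {a..b}" by simp
    then have "\<gamma> x \<notin> singular_locus" using \<gamma>(2) by blast
    from solutions_extend[OF this] obtain R where R: "R > 0" and
      ext: "\<forall>\<eta>\<in>ball (\<gamma> x) R. \<forall>F\<in>solutions \<eta>. \<exists>f. F = (\<lambda>i\<in>{1..9}. germ_at (webU i \<eta>) (f i)) \<and>
        (\<forall>i\<in>{1..9}. \<forall>p\<in>ball (\<gamma> x) R. f i analytic_on {webU i p}) \<and>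
        (\<forall>p\<in>ball (\<gamma> x) R. (\<Sum>i=1..9. f i (webU i p)) = 0)"
      by blast
    obtain d where d: "d > 0" "\<And>t. t \<in> {a..b} \<Longrightarrow> dist t x < d \<Longrightarrow> dist (\<gamma> t) (\<gamma> x) < R"
    proof -
      have "x \<in> {a..b}" using x by simp
      then show ?thesis using \<gamma>(1) R that unfolding continuous_on_iff by blast
    qed
    have "P u v" if uv: "u \<le> x" "x \<le> v" "v - u < d" for u v
      unfolding P_def
    proof (rule impI, rule impI)
      assume ab: "u \<in> {a..b}" "v \<in> {a..b}"
      have sub: "\<gamma> ` {u..v} \<subseteq> ball (\<gamma> x) R"
        using d(2) uv ab by (auto simp: dist_commute dist_real_def)
      have le: "u \<le> v" using uv by simp
      show "(\<forall>F\<in>solutions (\<gamma> u). \<exists>H\<in>solutions (\<gamma> v). transports \<gamma> u v F H) \<and>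
          (\<forall>H\<in>solutions (\<gamma> v). \<exists>F\<in>solutions (\<gamma> u). transports \<gamma> u v F H)"
        using transports_locally[OF le _ sub _ ext, of u] transports_locally[OF le _ sub _ ext, of v] le
        by (metis atLeastAtMost_iff order_refl)
    qed
    then show "\<exists>d>0. \<forall>u v. u \<le> x \<and> x \<le> v \<and> v - u < d \<longrightarrow> P u v" using d(1) by blast
  qed
  then show ?thesis using \<open>a \<le> b\<close> by (simp add: P_def)
qed

theorem mainTheorem2:
  fixes \<omega>0 \<omega>' :: "complex \<times> complex" and \<gamma> :: "real \<Rightarrow> complex \<times> complex"
  assumes "\<omega>0 = (1 / 3, 1 / 2)"
    and "\<omega>' \<in> - singular_locus"
    and "\<omega>' \<noteq> \<omega>0"
    and "path \<gamma>"
    and "path_image \<gamma> \<subseteq> - singular_locus"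
    and "pathstart \<gamma> = \<omega>0"
    and "pathfinish \<gamma> = \<omega>'"
  shows "(\<forall>F \<in> carrier (solution_space \<omega>0). \<forall>i \<in> {1..9}.
            \<exists>!B. continues_along (webU i \<circ> \<gamma>) (F i) B)
       \<and> (\<forall>F \<in> carrier (solution_space \<omega>0).
            tuple_continuation \<gamma> F \<in> carrier (solution_space \<omega>'))
       \<and> linear_iso complex_field (solution_space \<omega>0) (solution_space \<omega>') (tuple_continuation \<gamma>)"
proof -
  have \<gamma>: "continuous_on {0..1} \<gamma>" "\<gamma> ` {0..1} \<subseteq> - singular_locus"
    using assms(4,5) by (auto simp: path_def path_image_def)
  have ends: "\<gamma> 0 = \<omega>0" "\<gamma> 1 = \<omega>'" using assms(6,7) by (auto simp: pathstart_def pathfinish_def)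
  have car: "carrier (solution_space \<omega>) = solutions \<omega>" for \<omega> by (simp add: solution_space_def)
  have cont: "continuous_on {0..1} (webU i \<circ> \<gamma>)" if "i \<in> {1..9}" for i
    by (rule continuous_webU_path[OF \<gamma> that])
  note along = continues_along_iff[OF cont]
  note unique = continues_on_unique[OF cont zero_le_one]
  have ext: "F i = undefined" if "F \<in> solutions \<omega>" "i \<notin> {1..9}" for F \<omega> i
    using that PiE_arb unfolding solutions_def by blast
  have fwd: "\<exists>H\<in>solutions \<omega>'. transports \<gamma> 0 1 F H" if "F \<in> solutions \<omega>0" for F
    using transports_exist[OF zero_le_one \<gamma>] that unfolding ends by blast
  have bwd: "\<exists>F\<in>solutions \<omega>0. transports \<gamma> 0 1 F H" if "H \<in> solutions \<omega>'" for H
    using transports_exist[OF zero_le_one \<gamma>] that unfolding ends by blast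
  have tc: "tuple_continuation \<gamma> F = H"
    if FH: "transports \<gamma> 0 1 F H" "\<And>i. i \<notin> {1..9} \<Longrightarrow> H i = undefined" for F H
  proof
    fix i show "tuple_continuation \<gamma> F i = H i"
    proof (cases "i \<in> {1..9}")
      case True
      have c: "continues_on (webU i \<circ> \<gamma>) 0 1 (F i) (H i)"
        using FH(1) True by (auto simp: transports_def)
      have "continuation (webU i \<circ> \<gamma>) (F i) = H i"
        unfolding continuation_def along[OF True]
      proof (rule the_equality)
        show "continues_on (webU i \<circ> \<gamma>) 0 1 (F i) (H i)" by (rule c)
        show "B = H i" if "continues_on (webU i \<circ> \<gamma>) 0 1 (F i) B" for B
          using unique[OF True that c] by simp
      qed
      then show ?thesis using True by (simp add: tuple_continuation_def)
    next
      case False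
      show ?thesis
        unfolding FH(2)[OF False] tuple_continuation_def restrict_def using False by (rule if_not_P)
    qed
  qed
  have sol_tc: "tuple_continuation \<gamma> F \<in> solutions \<omega>' \<and>
      transports \<gamma> 0 1 F (tuple_continuation \<gamma> F)"
    if F: "F \<in> solutions \<omega>0" for F
  proof -
    obtain H where H: "H \<in> solutions \<omega>'" "transports \<gamma> 0 1 F H" using fwd[OF F] by blast
    have "tuple_continuation \<gamma> F = H" by (rule tc[OF H(2) ext[OF H(1)]])
    then show ?thesis using H by simp
  qed
  note sol = conjunct1[OF sol_tc] and trans = conjunct2[OF sol_tc]
  have trans_i: "continues_on (webU i \<circ> \<gamma>) 0 1 (F i) (tuple_continuation \<gamma> F i)"
    if "F \<in> solutions \<omega>0" "i \<in> {1..9}" for F i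
    using trans[OF that(1)] that(2) unfolding transports_def by blast
  have uni: "\<exists>!B. continues_along (webU i \<circ> \<gamma>) (F i) B"
    if F: "F \<in> solutions \<omega>0" and i: "i \<in> {1..9}" for F i
    unfolding along[OF i] using trans_i[OF F i] unique[OF i _ trans_i[OF F i]] by blast
  have inj: "inj_on (tuple_continuation \<gamma>) (solutions \<omega>0)"
  proof (rule inj_onI)
    fix F G assume FG: "F \<in> solutions \<omega>0" "G \<in> solutions \<omega>0"
      "tuple_continuation \<gamma> F = tuple_continuation \<gamma> G"
    show "F = G"
    proof
      fix i show "F i = G i"
      proof (cases "i \<in> {1..9}")
        case True
        show ?thesis
          using unique[OF True trans_i[OF FG(1) True] trans_i[OF FG(2) True]] FG(3) by simp
      next
        case False
        show ?thesis by (simp only: ext[OF FG(1) False] ext[OF FG(2) False])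
      qed
    qed
  qed
  have surj: "tuple_continuation \<gamma> ` solutions \<omega>0 = solutions \<omega>'"
  proof
    show "tuple_continuation \<gamma> ` solutions \<omega>0 \<subseteq> solutions \<omega>'" using sol by blast
    show "solutions \<omega>' \<subseteq> tuple_continuation \<gamma> ` solutions \<omega>0"
    proof
      fix H assume H: "H \<in> solutions \<omega>'"
      obtain F where F: "F \<in> solutions \<omega>0" "transports \<gamma> 0 1 F H" using bwd[OF H] by blast
      have "H = tuple_continuation \<gamma> F" by (rule tc[OF F(2) ext[OF H], symmetric])
      then show "H \<in> tuple_continuation \<gamma> ` solutions \<omega>0" using F(1) by (rule image_eqI)
    qed
  qed
  have add: "tuple_continuation \<gamma> (F \<oplus>\<^bsub>solution_space \<omega>0\<^esub> G)
      = tuple_continuation \<gamma> F \<oplus>\<^bsub>solution_space \<omega>'\<^esub> tuple_continuation \<gamma> G"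
    if F: "F \<in> solutions \<omega>0" and G: "G \<in> solutions \<omega>0" for F G
  proof (rule tc)
    show "transports \<gamma> 0 1 (F \<oplus>\<^bsub>solution_space \<omega>0\<^esub> G)
        (tuple_continuation \<gamma> F \<oplus>\<^bsub>solution_space \<omega>'\<^esub> tuple_continuation \<gamma> G)"
      unfolding transports_def
    proof
      fix i :: nat assume i: "i \<in> {1..9}"
      show "continues_on (webU i \<circ> \<gamma>) 0 1 ((F \<oplus>\<^bsub>solution_space \<omega>0\<^esub> G) i)
          ((tuple_continuation \<gamma> F \<oplus>\<^bsub>solution_space \<omega>'\<^esub> tuple_continuation \<gamma> G) i)"
        using continues_on_add[OF trans_i[OF F i] trans_i[OF G i]] i ends
        by (simp add: solution_space_def)
    qed
    show "(tuple_continuation \<gamma> F \<oplus>\<^bsub>solution_space \<omega>'\<^esub> tuple_continuation \<gamma> G) i = undefined"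
      if "i \<notin> {1..9}" for i
      unfolding solution_space_def ring.simps restrict_def using that by (rule if_not_P)
  qed
  have scale: "tuple_continuation \<gamma> (k \<odot>\<^bsub>solution_space \<omega>0\<^esub> F)
      = k \<odot>\<^bsub>solution_space \<omega>'\<^esub> tuple_continuation \<gamma> F"
    if F: "F \<in> solutions \<omega>0" for F k
  proof (rule tc)
    show "transports \<gamma> 0 1 (k \<odot>\<^bsub>solution_space \<omega>0\<^esub> F)
        (k \<odot>\<^bsub>solution_space \<omega>'\<^esub> tuple_continuation \<gamma> F)"
      unfolding transports_def
    proof
      fix i :: nat assume i: "i \<in> {1..9}"
      show "continues_on (webU i \<circ> \<gamma>) 0 1 ((k \<odot>\<^bsub>solution_space \<omega>0\<^esub> F) i)
          ((k \<odot>\<^bsub>solution_space \<omega>'\<^esub> tuple_continuation \<gamma> F) i)"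
        using continues_on_scale[OF trans_i[OF F i], of k] i ends
        by (simp add: solution_space_def)
    qed
    show "(k \<odot>\<^bsub>solution_space \<omega>'\<^esub> tuple_continuation \<gamma> F) i = undefined"
      if "i \<notin> {1..9}" for i
      unfolding solution_space_def module.simps restrict_def using that by (rule if_not_P)
  qed
  show ?thesis
    unfolding linear_iso_def car bij_betw_def
    by (intro conjI ballI uni sol inj surj add scale)
qed

end
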